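(* For every integer $m\ge 1$, $$ \begin{aligned} \zeta(4m+1) ={}& -\frac{16^m\left(2E_m-16^m G_{2m}\right)}{(16^m-1)E_m}\, S_{4m+1}(1)\\ & -\frac{2\cdot 16^m\, G_{2m}K_m\left(2\cdot 16^m-(-4)^m+1\right)}{(16^m-1)E_m}\, S_{4m+1}(2)\\ & -\frac{16^m\, G_{2m}(1-4K_m)-2E_m}{(16^m-1)E_m}\, S_{4m+1}(4). \end{aligned} $$
   Context: $\zeta$ is the Riemann zeta function. For a positive integer $n$ and real $r>0$, $S_n(r)=\sum_{k=1}^{\infty}\frac{1}{k^n(e^{\pi r k}-1)}$. The Bernoulli numbers $B_k$ are defined by $\frac{x}{e^x-1}=\sum_{n=0}^\infty \frac{B_n x^n}{n!}$ for $|x|<2\pi$. For a nonnegative integer $n$, $$G_n=\sum_{k=0}^{n+1}(-4)^k\frac{B_{2k}B_{2n+2-2k}}{(2k)!(2n+2-2k)!},\qquad H_n=\sum_{k=0}^{n}(-4)^{n+k}\frac{B_{4k}B_{4n+2-4k}}{(4k)!(4n+2-4k)!}.$$ For an integer $m\ge 1$, $$K_m=\frac{\frac12(1-4^{2m})}{1+(-4)^m-2^{4m+1}},\qquad E_m=\frac{4^{2m}}{2}G_{2m}-2^{4m+1}K_mH_m-2^{4m}K_mG_{2m}.$$ *)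

theory Defs
  imports "HOL-Complex_Analysis.Complex_Analysis"
begin

(* The Dirichlet series of the Riemann zeta function: this is zeta on the real
   half-line s > 1 only; its values for s \<le> 1 are meaningless. *)
definition zeta :: "real \<Rightarrow> real" where
  "zeta s = (\<Sum>k. 1 / real (Suc k) powr s)"

(* Read off the formal power series x / (e^x - 1), so B_1 = -1/2; the analytic expansion
   on |x| < 2 pi is bernoulli_generating_function below. *)
definition bernoulli :: "nat \<Rightarrow> real" where
  "bernoulli n = fact n * fps_nth (fps_X / (fps_exp 1 - 1)) n"

lemma bernoulli_fps_aux:
  "fps_exp 1 - 1 \<noteq> (0 :: 'a :: field_char_0 fps)" (is ?nz)
  "subdegree (1 - fps_exp 1 :: 'a fps) = 1" (is ?sub)
  "fps_X / (fps_exp 1 - 1) * (fps_exp 1 - 1) = (fps_X :: 'a fps)" (is ?quot)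
proof -
  have nz: "fps_exp 1 - 1 \<noteq> (0 ::'a fps)"
    by (auto simp: fps_eq_iff intro!: exI[of _ 1])
  have sub: "subdegree (1 - fps_exp 1 :: 'a fps) = 1"
    by (rule subdegreeI) auto
  have quot: "fps_X / (fps_exp 1 - 1) * (fps_exp 1 - 1) = (fps_X ::'a fps)"
  proof (rule dvd_div_mult_self)
    show "fps_exp 1 - 1 dvd (fps_X :: 'a fps)"
      by (subst fps_dvd_iff[OF nz]) (simp_all add: sub)
  qed
  show ?nz ?sub ?quot by (fact nz sub quot)+
qed

lemma bernoulli_generating_function:
  fixes x :: complex
  assumes "norm x < 2 * pi" "x \<noteq> 0"
  shows "(\<lambda>n. of_real (bernoulli n) * x ^ n / fact n) sums (x / (exp x - 1))"
proof -
  define R where "R = (fps_X / (fps_exp 1 - 1) :: real fps)"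
  define C where "C = (fps_X / (fps_exp 1 - 1) :: complex fps)"
  define R' where "R' = Abs_fps (\<lambda>n. complex_of_real (fps_nth R n))"
  have "R' * (fps_exp 1 - 1) = fps_X"
  proof (rule fps_ext)
    fix n
    have "fps_nth (R' * (fps_exp 1 - 1)) n = of_real (fps_nth (R * (fps_exp 1 - 1)) n)"
      by (simp add: fps_mult_nth R'_def if_distrib cong: if_cong)
    also have "R * (fps_exp 1 - 1) = fps_X" unfolding R_def by (rule bernoulli_fps_aux)
    finally show "fps_nth (R' * (fps_exp 1 - 1)) n = fps_nth fps_X n" by simp
  qed
  also have "fps_X = C * (fps_exp 1 - 1)"
    unfolding C_def by (rule bernoulli_fps_aux(3)[symmetric])
  finally have eq: "R' = C"
    using mult_right_cancel[OF bernoulli_fps_aux(1)] by blast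
  define f where "f = (\<lambda>z::complex. if z = 0 then 1 else z / (exp z - 1))"
  have exp: "f has_fps_expansion C"
    unfolding f_def C_def
    by (rule has_fps_expansion_divide) (auto intro!: fps_expansion_intros simp: bernoulli_fps_aux)
  have ne: "exp z \<noteq> 1" if "norm z < 2 * pi" "z \<noteq> 0" for z :: complex
  proof
    assume "exp z = 1"
    then obtain n :: int where n: "Re z = 0" "Im z = of_int (2 * n) * pi" by (auto simp: exp_eq_1)
    with \<open>z \<noteq> 0\<close> have "n \<noteq> 0" by (auto simp: complex_eq_iff)
    hence "1 \<le> \<bar>real_of_int n\<bar>" by linarith
    hence "2 * pi * 1 \<le> 2 * pi * \<bar>real_of_int n\<bar>"
      using pi_gt_zero by (intro mult_left_mono) linarith+
    also have "\<dots> = \<bar>Im z\<bar>"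
      unfolding n(2) abs_mult of_int_mult using pi_gt_zero by simp
    also have "\<dots> \<le> norm z" by (rule abs_Im_le_cmod)
    finally show False using that(1) by linarith
  qed
  have f_holo0: "f holomorphic_on ball 0 (2 * pi) - {0}"
  proof -
    have "(\<lambda>z. z / (exp z - 1)) holomorphic_on ball 0 (2 * pi) - {0}"
      by (intro holomorphic_intros) (use ne in \<open>simp_all add: dist_norm\<close>)
    thus ?thesis by (rule holomorphic_transform) (simp add: f_def)
  qed
  obtain s where s: "open s" "0 \<in> s" "f holomorphic_on s"
    by (rule has_fps_expansion_imp_holomorphic[OF exp])
  have "f holomorphic_on s \<union> (ball 0 (2 * pi) - {0})"
    by (rule holomorphic_on_Un) (simp_all add: s f_holo0 open_Diff)
  hence holo: "f holomorphic_on ball 0 (2 * pi)"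
    by (rule holomorphic_on_subset) (use s(2) in blast)
  have "(\<lambda>n. (deriv ^^ n) f 0 / fact n * (x - 0) ^ n) sums f x"
    by (rule holomorphic_power_series[OF holo]) (simp add: assms(1))
  moreover have "(deriv ^^ n) f 0 / fact n = fps_nth C n" for n
    by (rule fps_nth_fps_expansion[OF exp, symmetric])
  ultimately have "(\<lambda>n. fps_nth R' n * x^n) sums f x" using eq by simp
  thus ?thesis using assms by (simp add: R'_def R_def bernoulli_def f_def)
qed

(* suminf starts at index 0, hence Suc k. *)
definition S_sum :: "nat \<Rightarrow> real \<Rightarrow> real" where
  "S_sum n r = (\<Sum>k. 1 / (real (Suc k) ^ n * (exp (pi * r * real (Suc k)) - 1)))"

definition G_coeff :: "nat \<Rightarrow> real" where
  "G_coeff n = (\<Sum>k=0..n+1. (-4) ^ k *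
     (bernoulli (2*k) * bernoulli (2*n+2-2*k) / (fact (2*k) * fact (2*n+2-2*k))))"

definition H_coeff :: "nat \<Rightarrow> real" where
  "H_coeff n = (\<Sum>k=0..n. (-4) ^ (n+k) *
     (bernoulli (4*k) * bernoulli (4*n+2-4*k) / (fact (4*k) * fact (4*n+2-4*k))))"

definition K_coeff :: "nat \<Rightarrow> real" where
  "K_coeff m = (1/2 * (1 - 4 ^ (2*m))) / (1 + (-4) ^ m - 2 ^ (4*m+1))"

definition E_coeff :: "nat \<Rightarrow> real" where
  "E_coeff m = 4 ^ (2*m) / 2 * G_coeff (2*m)
     - 2 ^ (4*m+1) * K_coeff m * H_coeff m
     - 2 ^ (4*m) * K_coeff m * G_coeff (2*m)"

end

(* The partial fractions of coth turn sum_k coth(pi a k) / k^(2n+1), which is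
   zeta(2n+1) + 2 sum_k 1 / (k^(2n+1) (e^(2 pi a k) - 1)), into an absolutely convergent double sum
   over 1 / (k^(2n) (a^2 k^2 + j^2)).  Replacing a by 1/a exchanges k and j, and the partial
   fraction decomposition of 1 / (x^n (x + y)) in x = a^2 k^2, y = j^2 leaves only finitely many
   products of even zeta values.  This is Ramanujan's formula for zeta(2n+1), valid for complex a
   with Re a > 0.  For n = 2m, a = 2 relates zeta(4m+1), S(1), S(4) and G_2m; a = 1 - i relates
   zeta(4m+1), S(1), S(2), S(4) and H_m, since 1/a = (1 + i)/2 gives e^(2 pi k / a) = (-1)^k e^(pi k).
   Eliminating pi^(4m+1) from both relations gives the theorem.  That E_m is nonzero comes out of the
   relations themselves: otherwise zeta(4m+1) would drop out and the three sums S(r), which decrease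
   quickly in r, would have to balance. *)
theory Submission
  imports Defs
begin

section \<open>Partial fractions of the cotangent\<close>

lemma abs_summable_inverse_powers:
  assumes "s \<ge> 2"
  shows "(\<lambda>k. norm (1 / of_nat k ^ s :: 'a::real_normed_field)) summable_on {1..}"
proof -
  have "summable (\<lambda>k. 1 / real k ^ s)"
    using inverse_power_summable[OF assms, where 'a=real] by (simp add: field_simps)
  hence "(\<lambda>k. 1 / real k ^ s) summable_on UNIV"
    by (subst summable_on_UNIV_nonneg_real_iff) auto
  hence "(\<lambda>k. 1 / real k ^ s) summable_on {1..}"
    by (rule summable_on_subset_banach) auto
  thus ?thesis by (simp add: norm_divide norm_power)
qed

text \<open>Bridges two indexings: unordered sums here run over k >= 1, while \<open>sums\<close>
  and the definitions of \<open>zeta\<close> and \<open>S_sum\<close> start at 0 with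
  \<open>Suc k\<close>.\<close>

lemma has_sum_atLeast_1_iff:
  "(f has_sum S) {1..} \<longleftrightarrow> ((\<lambda>k. f (Suc k)) has_sum S) UNIV"
proof -
  have "{1..} = range Suc" by (auto simp: image_iff Suc_le_eq gr0_conv_Suc)
  thus ?thesis using has_sum_reindex[of Suc UNIV f S] by (simp add: o_def)
qed

lemma cot_partial_fractions:
  fixes z :: complex
  assumes "z \<notin> \<int>"
  shows "(\<lambda>n. 2 * z / (z\<^sup>2 - of_nat (Suc n) ^ 2)) sums (of_real pi * cot (of_real pi * z) - 1 / z)"
proof -
  have z: "z \<noteq> 0" "z \<notin> \<int>\<^sub>\<le>\<^sub>0" "1 - z \<notin> \<int>\<^sub>\<le>\<^sub>0" "1 - z \<notin> \<int>" "1 + z \<notin> \<int>"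
    using assms Ints_diff[of 1 "1 - z"] Ints_diff[of "1 + z" 1] by (auto dest: nonpos_Ints_Int)
  have z': "1 + z \<noteq> 0" "1 - z \<noteq> 0" using z(4,5) by (metis Ints_0)+
  have sin0: "sin (of_real pi * z) \<noteq> 0"
  proof
    assume "sin (of_real pi * z) = 0"
    then obtain n :: int where "of_real pi * z = of_real (of_int n) * of_real pi"
      by (auto simp: sin_eq_0)
    hence "z = of_int n" by (simp add: mult.commute)
    with assms show False by auto
  qed
  \<comment> \<open>The logarithmic derivative of the reflection formula is the cotangent.\<close>
  have "((\<lambda>z. rGamma z * rGamma (1 - z)) has_field_derivative
          rGamma z * rGamma (1 - z) * (Digamma (1 - z) - Digamma z)) (at z)"
    by (rule derivative_eq_intros refl z | use z in \<open>simp add: algebra_simps\<close>)+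
  moreover have "((\<lambda>z. rGamma z * rGamma (1 - z)) has_field_derivative cos (of_real pi * z)) (at z)"
    unfolding rGamma_reflection_complex by (auto intro!: derivative_eq_intros)
  ultimately have "rGamma z * rGamma (1 - z) * (Digamma (1 - z) - Digamma z) = cos (of_real pi * z)"
    by (rule DERIV_unique)
  hence 1: "Digamma (1 - z) - Digamma z = of_real pi * cot (of_real pi * z)"
    unfolding rGamma_reflection_complex using sin0 by (simp add: cot_def divide_simps mult_ac)
  have dig: "(\<lambda>n. inverse (of_nat (Suc n)) - inverse (u + of_nat n)) sums
      (Digamma u + euler_mascheroni)" if "u \<noteq> 0" for u :: complex
    using summable_sums[OF summable_Digamma[OF that]] by (simp only: Digamma_def diff_add_cancel)
  \<comment> \<open>Using \<open>1 + z\<close> instead of \<open>z\<close> pairs 1/(z + N) with 1/(z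
    - N) for N = n + 1. The recurrence of \<open>Digamma\<close> brings in the remaining term 1/z at
    the end.\<close>
  have "(\<lambda>n. (inverse (of_nat (Suc n)) - inverse ((1 - z) + of_nat n)) -
             (inverse (of_nat (Suc n)) - inverse ((1 + z) + of_nat n)))
          sums ((Digamma (1 - z) + euler_mascheroni) - (Digamma (1 + z) + euler_mascheroni))"
    by (intro sums_diff dig z')
  also have "(\<lambda>n. (inverse (of_nat (Suc n)) - inverse ((1 - z) + of_nat n)) -
             (inverse (of_nat (Suc n)) - inverse ((1 + z) + of_nat n))) =
             (\<lambda>n. 2 * z / (z\<^sup>2 - of_nat (Suc n) ^ 2))"
  proof
    fix n
    have "z \<noteq> of_nat (Suc n)" "z \<noteq> - of_nat (Suc n)"
      using assms by (metis Ints_of_nat Ints_minus)+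
    hence nz: "z - of_nat (Suc n) \<noteq> 0" "z + of_nat (Suc n) \<noteq> 0" by (simp_all add: add_eq_0_iff2)
    have inv: "inverse (u + v) - inverse (- (u - v)) = 2 * u / (u\<^sup>2 - v\<^sup>2)"
      if "u - v \<noteq> 0" "u + v \<noteq> 0" for u v :: complex
    proof -
      have "u\<^sup>2 - v\<^sup>2 = (u + v) * (u - v)" by (simp add: algebra_simps power2_eq_square)
      thus ?thesis using that unfolding inverse_minus_eq by (simp add: divide_simps)
    qed
    have "- (z - of_nat (Suc n)) = (1 - z) + of_nat n" "z + of_nat (Suc n) = (1 + z) + of_nat n"
      by simp_all
    with inv[OF nz] have "inverse ((1 + z) + of_nat n) - inverse ((1 - z) + of_nat n) =
        2 * z / (z\<^sup>2 - of_nat (Suc n) ^ 2)" by (simp only:)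
    moreover have "(a - b) - (a - c) = c - b" for a b c :: complex by simp
    ultimately show "(inverse (of_nat (Suc n)) - inverse ((1 - z) + of_nat n)) -
             (inverse (of_nat (Suc n)) - inverse ((1 + z) + of_nat n)) =
             2 * z / (z\<^sup>2 - of_nat (Suc n) ^ 2)" by (simp only:)
  qed
  also have "Digamma (1 + z) = Digamma z + 1 / z"
    using Digamma_plus1[OF z(1)] by (simp add: add.commute)
  finally show ?thesis by (simp add: 1 [symmetric] diff_diff_eq)
qed

text \<open>The cotangent expansion at z = i w, multiplied by i. The factor 1 + 2/(e^(2 pi w) - 1)
  is coth(pi w), in the form that separates the contribution of zeta from that of the sums
  S.\<close>

lemma coth_partial_fractions:
  fixes w :: complex
  assumes "\<i> * w \<notin> \<int>"
  shows "(\<lambda>n. 2 * w / (w\<^sup>2 + of_nat (Suc n) ^ 2))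
           sums (of_real pi * (1 + 2 / (exp (2 * of_real pi * w) - 1)) - 1 / w)"
proof -
  have w: "w \<noteq> 0" using assms by auto
  have sin: "sin (of_real pi * (\<i> * w)) \<noteq> 0"
  proof
    assume "sin (of_real pi * (\<i> * w)) = 0"
    then obtain n :: int where "of_real pi * (\<i> * w) = of_real (of_int n) * of_real pi"
      by (auto simp: sin_eq_0)
    hence "\<i> * w = of_int n" by (simp add: mult.commute)
    with assms show False by auto
  qed
  define e where "e = exp (of_real pi * w)"
  have e: "e \<noteq> 0" "exp (2 * of_real pi * w) = e\<^sup>2" "exp (- (of_real pi * w)) = 1 / e"
    by (simp_all add: e_def exp_minus inverse_eq_divide exp_double mult.assoc)
  have s: "sin (of_real pi * (\<i> * w)) = (1 / e - e) / (2 * \<i>)"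
    using e by (simp add: sin_exp_eq algebra_simps e_def)
  have c: "cos (of_real pi * (\<i> * w)) = (1 / e + e) / 2"
    using e by (simp add: cos_exp_eq algebra_simps e_def)
  have "e\<^sup>2 \<noteq> 1" using sin e(1) unfolding s by (auto simp: field_simps power2_eq_square)
  hence cot: "cot (of_real pi * (\<i> * w)) = - \<i> * (1 + 2 / (e\<^sup>2 - 1))"
  proof -
    have "cot (of_real pi * (\<i> * w)) = \<i> * ((1 / e + e) * e / ((1 / e - e) * e))"
    proof -
      have "x / 2 / (y / (2 * \<i>)) = \<i> * (x / y)" for x y :: complex
        by (cases "y = 0") (auto simp: field_simps)
      thus ?thesis using e(1) unfolding cot_def s c
        by (simp only: mult_divide_mult_cancel_right not_False_eq_True)
    qed
    also have "(1 / e + e) * e = e\<^sup>2 + 1" 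
      using e(1) by (simp add: algebra_simps power2_eq_square)
    also have "(1 / e - e) * e = - (e\<^sup>2 - 1)"
      using e(1) by (simp add: algebra_simps power2_eq_square)
    also have "(e\<^sup>2 + 1) / - (e\<^sup>2 - 1) = - (1 + 2 / (e\<^sup>2 - 1))"
      using \<open>e\<^sup>2 \<noteq> 1\<close> by (simp add: field_simps)
    finally show ?thesis by (simp only: mult_minus_left mult_minus_right)
  qed
  have "(\<lambda>n. \<i> * (2 * (\<i> * w) / ((\<i> * w)\<^sup>2 - of_nat (Suc n) ^ 2))) sums
          (\<i> * (of_real pi * cot (of_real pi * (\<i> * w)) - 1 / (\<i> * w)))"
    by (intro sums_mult cot_partial_fractions assms)
  also have "(\<lambda>n. \<i> * (2 * (\<i> * w) / ((\<i> * w)\<^sup>2 - of_nat (Suc n) ^ 2))) =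
             (\<lambda>n. 2 * w / (w\<^sup>2 + of_nat (Suc n) ^ 2))"
  proof
    fix n
    have "(\<i> * w)\<^sup>2 - of_nat (Suc n) ^ 2 = - (w\<^sup>2 + of_nat (Suc n) ^ 2)"
      by (simp add: power_mult_distrib)
    moreover have "\<i> * (2 * (\<i> * w)) = - (2 * w)" by simp
    ultimately show "\<i> * (2 * (\<i> * w) / ((\<i> * w)\<^sup>2 - of_nat (Suc n) ^ 2)) =
      2 * w / (w\<^sup>2 + of_nat (Suc n) ^ 2)"
      by (metis minus_divide_divide minus_minus times_divide_eq_right minus_divide_right minus_divide_left)
  qed
  also have "\<i> * (of_real pi * cot (of_real pi * (\<i> * w)) - 1 / (\<i> * w)) =
      of_real pi * (1 + 2 / (exp (2 * of_real pi * w) - 1)) - 1 / w"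
  proof -
    have "\<i> * (p * (- \<i> * y) - 1 / (\<i> * w)) = p * y - 1 / w" for p y
      using w by (simp add: right_diff_distrib field_simps)
    thus ?thesis unfolding cot e(2) .
  qed
  finally show ?thesis .
qed

section \<open>Zeta values at even integers\<close>

text \<open>The partial fraction expansions only yield \<open>sums\<close>, that is, limits of
  ordered partial sums. Once summability is known separately, the unordered sum must have the same
  value.\<close>

lemma has_sum_atLeast_1_sums:
  fixes f :: "nat \<Rightarrow> 'a::{comm_monoid_add,t2_space}"
  assumes "f summable_on {1..}" "(\<lambda>n. f (Suc n)) sums S"
  shows "(f has_sum S) {1..}"
proof -
  have f: "(f has_sum infsum f {1..}) {1..}" by (rule has_sum_infsum) fact
  hence "(\<lambda>n. f (Suc n)) sums infsum f {1..}"
    unfolding has_sum_atLeast_1_iff by (rule has_sum_imp_sums)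
  with assms(2) have "infsum f {1..} = S" by (rule sums_unique2[symmetric])
  with f show ?thesis by simp
qed

text \<open>Complex-valued and unordered, as the double sums below require. For s < 2 the family is
  not summable, so the value is the default 0.\<close>

definition zeta_nat :: "nat \<Rightarrow> complex" where
  "zeta_nat s = (\<Sum>\<^sub>\<infinity>k\<in>{1..}. 1 / of_nat k ^ s)"

lemma zeta_nat_has_sum:
  assumes "s \<ge> 2"
  shows "((\<lambda>k. 1 / of_nat k ^ s) has_sum zeta_nat s) {1..}"
  unfolding zeta_nat_def
  by (rule has_sum_infsum[OF abs_summable_summable[OF abs_summable_inverse_powers[OF assms]]])

definition bcoeff :: "nat \<Rightarrow> real" where "bcoeff n = bernoulli n / fact n"

lemma bcoeff_0: "bcoeff 0 = 1"
proof -
  \<comment> \<open>Comparing coefficients of x^1 isolates the constant term of x/(e^x - 1), because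
    e^x - 1 starts with x.\<close>
  have "fps_nth (fps_X / (fps_exp 1 - 1) * (fps_exp 1 - 1)) 1 = (fps_nth fps_X 1 :: real)"
    by (simp only: bernoulli_fps_aux)
  thus ?thesis by (simp add: bcoeff_def bernoulli_def fps_mult_nth)
qed

lemma abs_summable_on_product:
  fixes f :: "'a \<Rightarrow> 'c::real_normed_div_algebra" and g :: "'b \<Rightarrow> 'c"
  assumes "(\<lambda>x. norm (f x)) summable_on A" "(\<lambda>y. norm (g y)) summable_on B"
  shows "(\<lambda>(x, y). norm (f x * g y)) summable_on A \<times> B"
proof -
  have "((\<lambda>y. norm (f x) * norm (g y)) has_sum norm (f x) * (\<Sum>\<^sub>\<infinity>y\<in>B. norm (g y))) B" for x
    by (intro has_sum_cmult_right has_sum_infsum assms)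
  hence "(\<lambda>(x, y). norm (f x) * norm (g y)) summable_on A \<times> B"
    by (intro summable_on_SigmaI[where g = "\<lambda>x. norm (f x) * (\<Sum>\<^sub>\<infinity>y\<in>B. norm (g y))"])
       (auto intro!: summable_on_cmult_left assms)
  thus ?thesis by (simp add: case_prod_unfold norm_mult)
qed

lemma i_times_notin_Ints:
  assumes "norm u < 1" "u \<noteq> 0"
  shows "\<i> * u \<notin> \<int>"
proof
  assume "\<i> * u \<in> \<int>"
  then obtain n where n: "\<i> * u = of_int n" by (auto elim: Ints_cases)
  have "norm u = norm (\<i> * u)" by (simp add: norm_mult)
  also have "\<dots> = \<bar>real_of_int n\<bar>" unfolding n by simp
  finally have "n = 0" using assms(1) by linarith
  with n assms(2) show False by simp
qed

text \<open>Put x = -u^2. The double series of x^i / j^(2i) gives zeta(2i) when summed over j first;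
  summed over i first, it is geometric and gives x/(j^2 - x), a multiple of the j-th partial
  fraction of coth(pi u).\<close>

lemma zeta_nat_power_series:
  fixes u :: complex
  assumes u: "norm u < 1" "u \<noteq> 0"
  shows "((\<lambda>i. (- (u\<^sup>2)) ^ i * zeta_nat (2 * i)) has_sum
           (1 - of_real pi * u * (1 + 2 / (exp (2 * of_real pi * u) - 1))) / 2) {1..}"
proof -
  define x where "x = - (u\<^sup>2)"
  have x: "norm x < 1" using u by (simp add: x_def norm_power power_less_one_iff)
  have "(\<lambda>i. norm (x ^ i)) summable_on {1..}"
    using has_sum_geometric_from_1[of "norm x"] x by (auto simp: norm_power summable_on_def)
  \<comment> \<open>Since i >= 1, j^(2i) >= j^2, so the double series is dominated by a product of a
    geometric series and the series of 1/j^2; this justifies the exchange.\<close>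
  hence "(\<lambda>(i, j). norm (x ^ i * (1 / of_nat j ^ 2))) summable_on ({1..} \<times> {1..} :: (nat \<times> nat) set)"
    by (intro abs_summable_on_product abs_summable_inverse_powers) auto
  hence "(\<lambda>p. norm ((\<lambda>(i, j). x ^ i * (1 / of_nat j ^ (2 * i))) p)) summable_on
           ({1..} \<times> {1..} :: (nat \<times> nat) set)"
  proof (rule Infinite_Sum.abs_summable_on_comparison_test', safe)
    fix i j :: nat
    assume ij: "1 \<le> i" "1 \<le> j"
    have "real j ^ 2 \<le> real j ^ (2 * i)" using ij by (intro power_increasing) auto
    thus "norm (x ^ i * (1 / of_nat j ^ (2 * i))) \<le> norm (x ^ i * (1 / of_nat j ^ 2))"
      using ij by (auto simp: norm_mult norm_power norm_divide intro!: divide_left_mono)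
  qed
  from has_sum_infsum[OF abs_summable_summable[OF this]] obtain S where
    S: "((\<lambda>(i, j). x ^ i * (1 / of_nat j ^ (2 * i))) has_sum S) ({1..} \<times> {1..} :: (nat \<times> nat) set)"
    by blast
  have left: "((\<lambda>i. x ^ i * zeta_nat (2 * i)) has_sum S) {1..}"
  proof (rule has_sum_SigmaD[OF S])
    fix i :: nat assume "i \<in> {1..}"
    hence "((\<lambda>j. x ^ i * (1 / of_nat j ^ (2 * i))) has_sum (x ^ i * zeta_nat (2 * i))) {1..}"
      by (intro has_sum_cmult_right zeta_nat_has_sum) auto
    thus "((\<lambda>j. case (i, j) of (i, j) \<Rightarrow> x ^ i * (1 / of_nat j ^ (2 * i))) has_sum
            (x ^ i * zeta_nat (2 * i))) {1..}" by simp
  qed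
  have j: "((\<lambda>i. x ^ i * (1 / of_nat j ^ (2 * i))) has_sum (- u / 2 * (2 * u / (u\<^sup>2 + of_nat j ^ 2)))) {1..}"
    if "j \<ge> 1" for j
  proof -
    have j0: "(of_nat j :: complex) ^ 2 \<noteq> 0" using that by simp
    have "norm x < real j ^ 2" using x that by (smt (verit) one_le_power of_nat_1 of_nat_le_iff)
    hence "norm (x / of_nat j ^ 2) < 1" using that by (simp add: norm_divide norm_power)
    from has_sum_geometric_from_1[OF this]
    have "((\<lambda>i. (x / of_nat j ^ 2) ^ i) has_sum x / of_nat j ^ 2 / (1 - x / of_nat j ^ 2)) {1..}" .
    also have "(\<lambda>i. (x / of_nat j ^ 2) ^ i) = (\<lambda>i. x ^ i * (1 / of_nat j ^ (2 * i)))"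
      by (simp add: power_divide power_mult)
    also have "x / of_nat j ^ 2 / (1 - x / of_nat j ^ 2) = x / (of_nat j ^ 2 - x)"
      using j0 by (simp add: diff_divide_eq_iff)
    also have "\<dots> = - u / 2 * (2 * u / (u\<^sup>2 + of_nat j ^ 2))"
      by (simp add: x_def power2_eq_square add.commute)
    finally show ?thesis .
  qed
  have "((\<lambda>j. - u / 2 * (2 * u / (u\<^sup>2 + of_nat j ^ 2))) has_sum S) {1..}"
  proof (rule has_sum_SigmaD)
    show "((\<lambda>(j, i). x ^ i * (1 / of_nat j ^ (2 * i))) has_sum S) ({1..} \<times> {1..} :: (nat \<times> nat) set)"
      using S by (subst has_sum_swap) (simp add: case_prod_unfold)
  qed (use j in auto)
  hence "(\<lambda>n. - u / 2 * (2 * u / (u\<^sup>2 + of_nat (Suc n) ^ 2))) sums S"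
    unfolding has_sum_atLeast_1_iff by (rule has_sum_imp_sums)
  moreover have "(\<lambda>n. - u / 2 * (2 * u / (u\<^sup>2 + of_nat (Suc n) ^ 2))) sums
      (- u / 2 * (of_real pi * (1 + 2 / (exp (2 * of_real pi * u) - 1)) - 1 / u))"
    by (intro sums_mult coth_partial_fractions i_times_notin_Ints u)
  ultimately have "S = - u / 2 * (of_real pi * (1 + 2 / (exp (2 * of_real pi * u) - 1)) - 1 / u)"
    by (rule sums_unique2)
  also have "\<dots> = (1 - of_real pi * u * (1 + 2 / (exp (2 * of_real pi * u) - 1))) / 2"
  proof -
    have "- u / 2 * (of_real pi * y - 1 / u) = (1 - of_real pi * u * y) / 2" for y
      using u(2) by (simp add: field_simps)
    thus ?thesis .
  qed
  finally show ?thesis using left by (simp only: x_def)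
qed

text \<open>Euler's formula: the Bernoulli generating function and
  \<open>zeta_nat_power_series\<close> both expand pi u coth(pi u) at 0, and the coefficients of
  such an expansion are unique.\<close>

theorem zeta_nat_even:
  assumes "k \<ge> 1"
  shows "zeta_nat (2 * k) = of_real ((-1) ^ (k + 1) * (2 * pi) ^ (2 * k) * bcoeff (2 * k) / 2)"
proof -
  \<comment> \<open>The extra pi at n = 1 comes from pi u coth(pi u) = 2 pi u/(e^(2 pi u) - 1) + pi
    u; it cancels the contribution of B_1 = -1/2.\<close>
  define F where "F = Abs_fps (\<lambda>n. of_real (bcoeff n * (2 * pi) ^ n) + (if n = 1 then of_real pi else 0 :: complex))"
  \<comment> \<open>The index 0 needs its own case: \<open>zeta_nat 0\<close> is the default 0,
    whereas the general formula would give 1 only with zeta(0) = -1/2.\<close>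
  define g where "g = (\<lambda>n. if n = 0 then 1 else if even n then - 2 * (-1) ^ (n div 2) * zeta_nat n else 0)"
  define h where "h = (\<lambda>u::complex. if u = 0 then 1 else of_real pi * u * (1 + 2 / (exp (2 * of_real pi * u) - 1)))"
  have ev: "eventually (\<lambda>u::complex. u \<in> ball 0 1) (nhds 0)"
    by (rule eventually_nhds_in_open) auto
  have "h has_fps_expansion F"
  proof (rule has_fps_expansionI, use ev in eventually_elim)
    case (elim u)
    show "(\<lambda>n. fps_nth F n * u ^ n) sums h u"
    proof (cases "u = 0")
      case True
      moreover have "fps_nth F 0 = 1" by (simp add: F_def bcoeff_0)
      ultimately show ?thesis by (simp only: powser_sums_zero_iff h_def if_True refl)
    next
      case False
      have "(\<lambda>n. of_real (bernoulli n) * (2 * of_real pi * u) ^ n / fact n +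
               (if n = 1 then of_real pi * u ^ n else 0))
              sums (2 * of_real pi * u / (exp (2 * of_real pi * u) - 1) + of_real pi * u ^ 1)"
        using False elim
        by (intro sums_add bernoulli_generating_function sums_single) (auto simp: norm_mult)
      also have "2 * of_real pi * u / (exp (2 * of_real pi * u) - 1) + of_real pi * u ^ 1 = h u"
        using False by (simp add: h_def algebra_simps)
      also have "(\<lambda>n. of_real (bernoulli n) * (2 * of_real pi * u) ^ n / fact n +
               (if n = 1 then of_real pi * u ^ n else 0)) = (\<lambda>n. fps_nth F n * u ^ n)"
        by (auto simp: F_def bcoeff_def power_mult_distrib algebra_simps)
      finally show ?thesis .
    qed
  qed
  moreover have "h has_fps_expansion Abs_fps g"
  proof (rule has_fps_expansionI, use ev in eventually_elim)
    case (elim u)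
    show "(\<lambda>n. fps_nth (Abs_fps g) n * u ^ n) sums h u"
    proof (cases "u = 0")
      case True
      thus ?thesis by (simp add: g_def h_def)
    next
      case False
      have "((\<lambda>i. - 2 * ((- (u\<^sup>2)) ^ i * zeta_nat (2 * i))) has_sum
           - 2 * ((1 - of_real pi * u * (1 + 2 / (exp (2 * of_real pi * u) - 1))) / 2)) {1..}"
        using False elim by (intro has_sum_cmult_right zeta_nat_power_series) auto
      hence "(\<lambda>i. - 2 * ((- (u\<^sup>2)) ^ Suc i * zeta_nat (2 * Suc i))) sums
           (- 2 * ((1 - of_real pi * u * (1 + 2 / (exp (2 * of_real pi * u) - 1))) / 2))"
        unfolding has_sum_atLeast_1_iff by (rule has_sum_imp_sums)
      also have "- 2 * ((1 - of_real pi * u * (1 + 2 / (exp (2 * of_real pi * u) - 1))) / 2) = h u - g (2 * 0) * u ^ (2 * 0)"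
        using False by (simp add: g_def h_def)
      also have "(\<lambda>i. - 2 * ((- (u\<^sup>2)) ^ Suc i * zeta_nat (2 * Suc i))) = (\<lambda>i. g (2 * Suc i) * u ^ (2 * Suc i))"
        by (rule ext, subst power_minus) (simp add: g_def power_mult power2_eq_square)
      finally have "(\<lambda>i. g (2 * i) * u ^ (2 * i)) sums h u" by (subst (asm) sums_Suc_iff) simp
      hence "(\<lambda>n. g n * u ^ n) sums h u"
        by (subst (asm) sums_mono_reindex[of "\<lambda>i. 2 * i" "\<lambda>n. g n * u ^ n"])
           (auto simp: strict_mono_def g_def elim!: evenE)
      thus ?thesis by simp
    qed
  qed
  ultimately have "F = Abs_fps g" by (rule fps_expansion_unique_complex)
  hence "fps_nth F (2 * k) = fps_nth (Abs_fps g) (2 * k)" by simp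
  hence eq: "of_real (bcoeff (2 * k) * (2 * pi) ^ (2 * k)) = - 2 * (-1) ^ k * zeta_nat (2 * k)"
    using assms unfolding F_def g_def by simp
  have "zeta_nat (2 * k) = (-1) ^ k * (-1) ^ k * zeta_nat (2 * k)"
    by (simp flip: power_mult_distrib)
  also have "\<dots> = (-1) ^ (k + 1) * (- 2 * (-1) ^ k * zeta_nat (2 * k)) / 2"
    by simp
  also have "\<dots> = of_real ((-1) ^ (k + 1) * (2 * pi) ^ (2 * k) * bcoeff (2 * k) / 2)"
    unfolding eq [symmetric] by simp
  finally show ?thesis .
qed

section \<open>Ramanujan's formula\<close>

text \<open>Factor a^2 x^2 + y^2 = (y + i a x)(y - i a x). For real x and y the imaginary parts of
  the factors are \<open>Re a * x\<close> and its negative, and they bound the norms from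
  below.\<close>

lemma norm_quadratic_ge1:
  "norm (a\<^sup>2 * of_real x ^ 2 + of_real y ^ 2) \<ge> (Re a * x)\<^sup>2"
proof -
  have "a\<^sup>2 * of_real x ^ 2 + of_real y ^ 2 =
      (of_real y + \<i> * a * of_real x) * (of_real y - \<i> * a * of_real x)"
    by (simp add: algebra_simps power2_eq_square)
  moreover have "norm (of_real y + \<i> * a * of_real x) \<ge> \<bar>Re a * x\<bar>"
    using abs_Im_le_cmod[of "of_real y + \<i> * a * of_real x"] by simp
  moreover have "norm (of_real y - \<i> * a * of_real x) \<ge> \<bar>Re a * x\<bar>"
    using abs_Im_le_cmod[of "of_real y - \<i> * a * of_real x"] by simp
  ultimately have "norm (a\<^sup>2 * of_real x ^ 2 + of_real y ^ 2) \<ge> \<bar>Re a * x\<bar> * \<bar>Re a * x\<bar>"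
    by (simp only: norm_mult) (intro mult_mono norm_ge_zero abs_ge_zero)
  thus ?thesis by (simp only: power2_eq_square abs_mult_self_eq)
qed

lemma Re_inverse_pos: "Re a > 0 \<Longrightarrow> Re (1 / a) > 0"
  by (simp add: Re_divide) (auto intro!: divide_pos_pos add_pos_nonneg)

text \<open>Taking out a^2 leaves the same form for 1/a with x and y exchanged, so the previous
  bound applies. The result is growth in y that is uniform in x.\<close>

lemma norm_quadratic_ge2:
  assumes "Re a > 0"
  shows "norm (a\<^sup>2 * of_real x ^ 2 + of_real y ^ 2) \<ge> (norm a * Re (1 / a))\<^sup>2 * y\<^sup>2"
proof -
  have "a \<noteq> 0" using assms by auto
  hence "a\<^sup>2 * of_real x ^ 2 + of_real y ^ 2 = a\<^sup>2 * ((1 / a)\<^sup>2 * of_real y ^ 2 + of_real x ^ 2)"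
    by (simp add: field_simps)
  hence "norm (a\<^sup>2 * of_real x ^ 2 + of_real y ^ 2) =
     (norm a)\<^sup>2 * norm ((1 / a)\<^sup>2 * of_real y ^ 2 + of_real x ^ 2)"
    by (simp add: norm_mult norm_power)
  moreover have "(norm a)\<^sup>2 * norm ((1 / a)\<^sup>2 * of_real y ^ 2 + of_real x ^ 2) \<ge>
      (norm a)\<^sup>2 * (Re (1 / a) * y)\<^sup>2"
    by (intro mult_left_mono norm_quadratic_ge1) auto
  ultimately show ?thesis by (simp only: power_mult_distrib mult.assoc)
qed

lemma quadratic_nonzero:
  assumes "Re a > 0" "j \<ge> 1"
  shows "a\<^sup>2 * of_nat k ^ 2 + of_nat j ^ 2 \<noteq> 0"
proof -
  have "a \<noteq> 0" using assms by auto
  hence "0 < (norm a * Re (1 / a))\<^sup>2 * (real j)\<^sup>2"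
    using assms(2) Re_inverse_pos[OF assms(1)]
    by (intro mult_pos_pos zero_less_power) auto
  also have "\<dots> \<le> norm (a\<^sup>2 * of_nat k ^ 2 + of_nat j ^ 2)"
    using norm_quadratic_ge2[OF assms(1), where x = "real k" and y = "real j"] by simp
  finally show ?thesis by auto
qed

definition lattice_sum :: "nat \<Rightarrow> complex \<Rightarrow> complex" where
  "lattice_sum n a = (\<Sum>\<^sub>\<infinity>(k, j)\<in>{1..} \<times> {1..}. 1 / (of_nat k ^ (2 * n) * (a\<^sup>2 * of_nat k ^ 2 + of_nat j ^ 2)))"

text \<open>The quadratic factor is at least c j^2 in norm, so the terms are dominated by a constant
  times k^(-2n) j^(-2), a product of two convergent series for n >= 1.\<close>

lemma lattice_sum_has_sum:
  assumes "Re a > 0" "n \<ge> 1"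
  shows "((\<lambda>(k, j). 1 / (of_nat k ^ (2 * n) * (a\<^sup>2 * of_nat k ^ 2 + of_nat j ^ 2)))
           has_sum lattice_sum n a) ({1..} \<times> {1..})"
proof -
  define c where "c = (norm a * Re (1 / a))\<^sup>2"
  have c: "c > 0" using assms(1) Re_inverse_pos[OF assms(1)] by (auto simp: c_def)
  have "(\<lambda>(k, j). norm ((1 / of_nat k ^ (2 * n)) * (1 / of_nat j ^ 2) :: real))
         summable_on {1..} \<times> {1..}"
    by (intro abs_summable_on_product abs_summable_inverse_powers) (use assms in auto)
  hence "(\<lambda>p. 1 / c * (case p of (k, j) \<Rightarrow> norm ((1 / of_nat k ^ (2 * n)) * (1 / of_nat j ^ 2) :: real)))
         summable_on {1..} \<times> {1..}"
    by (rule summable_on_cmult_right)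
  hence "(\<lambda>p. norm (case p of (k, j) \<Rightarrow> 1 / (of_nat k ^ (2 * n) * (a\<^sup>2 * of_nat k ^ 2 + of_nat j ^ 2))))
           summable_on {1..} \<times> {1..}"
  proof (rule Infinite_Sum.abs_summable_on_comparison_test')
    fix p :: "nat \<times> nat" assume "p \<in> {1..} \<times> {1..}"
    then obtain k j where p: "p = (k, j)" and kj: "k \<ge> 1" "j \<ge> 1" by (cases p) auto
    have "c * real j ^ 2 \<le> norm (a\<^sup>2 * of_nat k ^ 2 + of_nat j ^ 2)"
      using norm_quadratic_ge2[OF assms(1), where x = "real k" and y = "real j"] unfolding c_def of_real_of_nat_eq .
    hence "1 / norm (a\<^sup>2 * of_nat k ^ 2 + of_nat j ^ 2) \<le> 1 / (c * real j ^ 2)"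
      using c kj quadratic_nonzero[OF assms(1) kj(2), of k] by (intro divide_left_mono mult_pos_pos) auto
    hence "1 / real k ^ (2 * n) * (1 / norm (a\<^sup>2 * of_nat k ^ 2 + of_nat j ^ 2)) \<le>
        1 / real k ^ (2 * n) * (1 / (c * real j ^ 2))" by (intro mult_left_mono) auto
    thus "norm (case p of (k, j) \<Rightarrow> 1 / (of_nat k ^ (2 * n) * (a\<^sup>2 * of_nat k ^ 2 + of_nat j ^ 2)))
      \<le> 1 / c * (case p of (k, j) \<Rightarrow> norm ((1 / of_nat k ^ (2 * n)) * (1 / of_nat j ^ 2) :: real))"
      by (simp add: p norm_mult norm_divide norm_power mult_ac)
  qed
  thus ?thesis unfolding lattice_sum_def
    by (rule has_sum_infsum[OF abs_summable_summable])
qed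

section \<open>Sums of coth values in terms of the lattice sum\<close>

text \<open>The numerator is \<open>coth (\<pi> a k)\<close>.\<close>

definition coth_sum :: "nat \<Rightarrow> complex \<Rightarrow> complex" where
  "coth_sum n a = (\<Sum>\<^sub>\<infinity>k\<in>{1..}. (1 + 2 / (exp (2 * of_real pi * (a * of_nat k)) - 1)) / of_nat k ^ (2 * n + 1))"

text \<open>Summing the lattice sum over j first, the coth expansion at w = a k evaluates the inner
  sum. Its part -1/(a k), divided by 2 a k^(2n+1), accumulates to a multiple of zeta(2n+2).\<close>

lemma coth_sum_has_sum:
  assumes "Re a > 0" "n \<ge> 1"
  shows "((\<lambda>k. (1 + 2 / (exp (2 * of_real pi * (a * of_nat k)) - 1)) / of_nat k ^ (2 * n + 1))
            has_sum (2 * a * lattice_sum n a + zeta_nat (2 * n + 2) / a) / of_real pi) {1..}" (is ?th1)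
    and "of_real pi * coth_sum n a = 2 * a * lattice_sum n a + zeta_nat (2 * n + 2) / a" (is ?th2)
proof -
  define C where "C = (\<lambda>k. 1 + 2 / (exp (2 * of_real pi * (a * of_nat k)) - 1))"
  have a: "a \<noteq> 0" using assms by auto
  let ?f = "\<lambda>k j. 1 / (of_nat k ^ (2 * n) * (a\<^sup>2 * of_nat k ^ 2 + of_nat j ^ 2))"
  have inner: "((\<lambda>j. ?f k j) has_sum (1 / (2 * a * of_nat k ^ (2 * n + 1)) * (of_real pi * C k - 1 / (a * of_nat k)))) {1..}"
    if k: "k \<in> {1..}" for k
  proof (rule has_sum_atLeast_1_sums)
    have "(case_prod ?f) summable_on {1..} \<times> {1..}"
      using lattice_sum_has_sum[OF assms] by (auto simp: summable_on_def)
    from summable_on_SigmaD1[OF this k] show "(\<lambda>j. ?f k j) summable_on {1..}" by simp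
  next
    have "\<i> * (a * of_nat k) \<notin> \<int>"
    proof
      assume "\<i> * (a * of_nat k) \<in> \<int>"
      then obtain z where "\<i> * (a * of_nat k) = of_int z" by (auto elim: Ints_cases)
      hence "Im (\<i> * (a * of_nat k)) = 0" by simp
      thus False using assms k by simp
    qed
    hence "(\<lambda>j. 1 / (2 * a * of_nat k ^ (2 * n + 1)) * (2 * (a * of_nat k) / ((a * of_nat k)\<^sup>2 + of_nat (Suc j) ^ 2))) sums
       (1 / (2 * a * of_nat k ^ (2 * n + 1)) * (of_real pi * C k - 1 / (a * of_nat k)))"
      unfolding C_def by (intro sums_mult coth_partial_fractions)
    also have "(\<lambda>j. 1 / (2 * a * of_nat k ^ (2 * n + 1)) * (2 * (a * of_nat k) / ((a * of_nat k)\<^sup>2 + of_nat (Suc j) ^ 2))) =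
      (\<lambda>j. ?f k (Suc j))"
    proof
      fix j
      have "1 / (2 * a * (K * p)) * (2 * (a * K) / q) = 1 / (p * q)" if "K \<noteq> 0" for K p q :: complex
        using that a by (simp add: field_simps)
      from this[of "of_nat k" "of_nat k ^ (2 * n)" "(a * of_nat k)\<^sup>2 + of_nat (Suc j) ^ 2"]
      show "1 / (2 * a * of_nat k ^ (2 * n + 1)) * (2 * (a * of_nat k) / ((a * of_nat k)\<^sup>2 + of_nat (Suc j) ^ 2)) = ?f k (Suc j)"
        using k by (simp add: power_mult_distrib)
    qed
    finally show "(\<lambda>j. ?f k (Suc j)) sums
       (1 / (2 * a * of_nat k ^ (2 * n + 1)) * (of_real pi * C k - 1 / (a * of_nat k)))" .
  qed
  have "((\<lambda>k. 1 / (2 * a * of_nat k ^ (2 * n + 1)) * (of_real pi * C k - 1 / (a * of_nat k))) has_sum lattice_sum n a) {1..}"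
    by (rule has_sum_SigmaD[OF lattice_sum_has_sum[OF assms]]) (use inner in auto)
  hence "((\<lambda>k. 2 * a / of_real pi * (1 / (2 * a * of_nat k ^ (2 * n + 1)) * (of_real pi * C k - 1 / (a * of_nat k))) +
           1 / (a * of_real pi) * (1 / of_nat k ^ (2 * n + 2))) has_sum
        (2 * a / of_real pi * lattice_sum n a + 1 / (a * of_real pi) * zeta_nat (2 * n + 2))) {1..}"
    by (intro has_sum_add has_sum_cmult_right zeta_nat_has_sum) auto
  also have "?this \<longleftrightarrow> ((\<lambda>k. C k / of_nat k ^ (2 * n + 1)) has_sum
        (2 * a / of_real pi * lattice_sum n a + 1 / (a * of_real pi) * zeta_nat (2 * n + 2))) {1..}"
  proof (rule has_sum_cong)
    fix k :: nat assume "k \<in> {1..}"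
    hence k: "(of_nat k :: complex) \<noteq> 0" by auto
    have "2 * a / P * (1 / (2 * a * (K * p)) * (P * c - 1 / (a * K))) + 1 / (a * P) * (1 / (K * K * p)) = c / (K * p)"
      if "K \<noteq> 0" "P \<noteq> 0" "p \<noteq> 0" for K p P c :: complex
      using that a by (simp add: field_simps)
    from this[of "of_nat k" "of_real pi" "of_nat k ^ (2 * n)" "C k"] k
    show "2 * a / of_real pi * (1 / (2 * a * of_nat k ^ (2 * n + 1)) * (of_real pi * C k - 1 / (a * of_nat k))) +
           1 / (a * of_real pi) * (1 / of_nat k ^ (2 * n + 2)) = C k / of_nat k ^ (2 * n + 1)"
      by (simp add: mult.assoc)
  qed
  also have "2 * a / of_real pi * lattice_sum n a + 1 / (a * of_real pi) * zeta_nat (2 * n + 2) =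
     (2 * a * lattice_sum n a + zeta_nat (2 * n + 2) / a) / of_real pi"
    using a by (simp add: field_simps)
  finally show th1: ?th1 unfolding C_def .
  show ?th2 using infsumI[OF th1] by (simp add: coth_sum_def)
qed

lemma has_sum_sum_finite:
  fixes f :: "'i \<Rightarrow> 'a \<Rightarrow> 'b::topological_comm_monoid_add"
  assumes "\<And>i. i \<in> I \<Longrightarrow> (f i has_sum s i) A"
  shows "((\<lambda>x. \<Sum>i\<in>I. f i x) has_sum (\<Sum>i\<in>I. s i)) A"
  using assms by (induction I rule: infinite_finite_induct) (auto intro!: has_sum_add)

lemma has_sum_product:
  fixes f :: "'a \<Rightarrow> complex" and g :: "'b \<Rightarrow> complex"
  assumes "(\<lambda>x. norm (f x)) summable_on A" "(\<lambda>y. norm (g y)) summable_on B"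
  assumes "(f has_sum s) A" "(g has_sum t) B"
  shows "((\<lambda>(x, y). f x * g y) has_sum (s * t)) (A \<times> B)"
proof (rule has_sum_SigmaI[where g = "\<lambda>x. f x * t"])
  show "(\<lambda>(x, y). f x * g y) summable_on A \<times> B"
    using abs_summable_on_product[OF assms(1,2)]
    unfolding case_prod_unfold by (rule abs_summable_summable)
qed (use assms in \<open>auto intro!: has_sum_cmult_left has_sum_cmult_right\<close>)

text \<open>With x = 1/k^2, y = 1/j^2 and w = 1/(a^2 k^2 + j^2) one has w (x + a^2 y) = x y. The
  combined summand is (x^n - (-a^2 y)^n) w, and x + a^2 y divides the difference of powers. What
  remains is a combination of x^(n-i) y^(i+1) with both exponents positive, so each sums to a
  product of even zeta values.\<close>

lemma lattice_sum_reciprocity: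
  assumes a: "Re a > 0" and n: "n \<ge> 1"
  shows "lattice_sum n a - (- (a\<^sup>2)) ^ n * (lattice_sum n (1 / a) / a\<^sup>2) =
           (\<Sum>i<n. (- (a\<^sup>2)) ^ i * (zeta_nat (2 * (n - i)) * zeta_nat (2 * (i + 1))))"
proof -
  have a0: "a \<noteq> 0" using a by auto
  let ?f = "\<lambda>b k j. 1 / (of_nat k ^ (2 * n) * (b\<^sup>2 * of_nat k ^ 2 + of_nat j ^ 2)) :: complex"
  \<comment> \<open>Exchanging k and j turns the form for 1/a into the form for a divided by a^2, so
    the two sums can be combined term by term.\<close>
  have "((\<lambda>(k, j). ?f (1 / a) j k) has_sum lattice_sum n (1 / a)) ({1..} \<times> {1..})"
    using lattice_sum_has_sum[OF Re_inverse_pos[OF a] n] by (subst has_sum_swap) (simp add: case_prod_unfold)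
  hence "((\<lambda>p. (case p of (k, j) \<Rightarrow> ?f a k j) + - ((- (a\<^sup>2)) ^ n / a\<^sup>2) * (case p of (k, j) \<Rightarrow> ?f (1 / a) j k)) has_sum
           (lattice_sum n a + - ((- (a\<^sup>2)) ^ n / a\<^sup>2) * lattice_sum n (1 / a))) ({1..} \<times> {1..})"
    by (intro has_sum_add has_sum_cmult_right lattice_sum_has_sum a n)
  note lhs = this
  have rhs: "((\<lambda>p. \<Sum>i<n. (- (a\<^sup>2)) ^ i * (case p of (k, j) \<Rightarrow> (1 / of_nat k ^ (2 * (n - i))) * (1 / of_nat j ^ (2 * (i + 1))))) has_sum
         (\<Sum>i<n. (- (a\<^sup>2)) ^ i * (zeta_nat (2 * (n - i)) * zeta_nat (2 * (i + 1))))) ({1..} \<times> {1..})"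
    by (intro has_sum_sum_finite has_sum_cmult_right has_sum_product zeta_nat_has_sum
        abs_summable_inverse_powers) auto
  have eq: "(case p of (k, j) \<Rightarrow> ?f a k j) + - ((- (a\<^sup>2)) ^ n / a\<^sup>2) * (case p of (k, j) \<Rightarrow> ?f (1 / a) j k) =
      (\<Sum>i<n. (- (a\<^sup>2)) ^ i * (case p of (k, j) \<Rightarrow> (1 / of_nat k ^ (2 * (n - i))) * (1 / of_nat j ^ (2 * (i + 1)))))"
    if pmem: "p \<in> {1..} \<times> {1..}" for p
  proof -
    obtain k j where p: "p = (k, j)" "k \<ge> 1" "j \<ge> 1" using pmem by (cases p) auto
    define x :: complex where "x = 1 / (of_nat k)\<^sup>2"
    define y :: complex where "y = 1 / (of_nat j)\<^sup>2"
    define w where "w = 1 / (a\<^sup>2 * of_nat k ^ 2 + of_nat j ^ 2)"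
    have kj: "(of_nat k :: complex) \<noteq> 0" "(of_nat j :: complex) \<noteq> 0" using p by auto
    have w: "w * (x + a\<^sup>2 * y) = x * y"
      using kj quadratic_nonzero[OF a p(3), of k] unfolding w_def x_def y_def
      by (simp add: divide_simps)
    have 1: "?f a k j = x ^ n * w"
      by (simp add: x_def w_def power_divide flip: power_mult)
    have 2: "?f (1 / a) j k = a\<^sup>2 * (y ^ n * w)"
    proof -
      have "(1 / a)\<^sup>2 * of_nat j ^ 2 + of_nat k ^ 2 = (a\<^sup>2 * of_nat k ^ 2 + of_nat j ^ 2) / a\<^sup>2"
        using a0 by (simp add: field_simps)
      thus ?thesis by (simp add: y_def w_def power_divide flip: power_mult)
    qed
    have "x ^ n * w + - ((- (a\<^sup>2)) ^ n / a\<^sup>2) * (a\<^sup>2 * (y ^ n * w)) = (x ^ n - (- (a\<^sup>2 * y)) ^ n) * w"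
      using a0 by (simp add: algebra_simps flip: power_mult_distrib)
    also have "x ^ n - (- (a\<^sup>2 * y)) ^ n = (x + a\<^sup>2 * y) * (\<Sum>i<n. (- (a\<^sup>2 * y)) ^ i * x ^ (n - Suc i))"
    proof -
      have "x ^ n - (- (a\<^sup>2 * y)) ^ n = - ((- (a\<^sup>2 * y)) ^ n - x ^ n)" by simp
      also have "\<dots> = - ((- (a\<^sup>2 * y) - x) * (\<Sum>i<n. x ^ (n - Suc i) * (- (a\<^sup>2 * y)) ^ i))"
        by (subst power_diff_sumr2) simp
      also have "\<dots> = - (- (a\<^sup>2 * y) - x) * (\<Sum>i<n. (- (a\<^sup>2 * y)) ^ i * x ^ (n - Suc i))"
        by (simp only: mult_minus_left mult.commute[of "x ^ _"])
      finally show ?thesis by (simp add: add.commute)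
    qed
    also have "\<dots> * w = (\<Sum>i<n. (- (a\<^sup>2 * y)) ^ i * x ^ (n - Suc i)) * (w * (x + a\<^sup>2 * y))"
      by (simp only: mult_ac)
    also have "\<dots> = (\<Sum>i<n. (- (a\<^sup>2 * y)) ^ i * x ^ (n - Suc i) * (x * y))"
      unfolding w by (rule sum_distrib_right)
    also have "\<dots> = (\<Sum>i<n. (- (a\<^sup>2)) ^ i * (x ^ (n - i) * y ^ (i + 1)))"
    proof (rule sum.cong)
      fix i assume "i \<in> {..<n}"
      hence "x ^ (n - i) = x ^ (n - Suc i) * x" by (metis Suc_diff_Suc lessThan_iff mult.commute power_Suc)
      moreover have "(- (a\<^sup>2 * y)) ^ i = (- (a\<^sup>2)) ^ i * y ^ i" by (simp flip: power_mult_distrib)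
      ultimately show "(- (a\<^sup>2 * y)) ^ i * x ^ (n - Suc i) * (x * y) = (- (a\<^sup>2)) ^ i * (x ^ (n - i) * y ^ (i + 1))"
        by (simp add: mult_ac)
    qed simp
    finally show ?thesis unfolding p(1) prod.case 1 2
      by (simp only: x_def y_def power_divide power_one flip: power_mult)
  qed
  have "lattice_sum n a + - ((- (a\<^sup>2)) ^ n / a\<^sup>2) * lattice_sum n (1 / a) =
     (\<Sum>i<n. (- (a\<^sup>2)) ^ i * (zeta_nat (2 * (n - i)) * zeta_nat (2 * (i + 1))))"
    by (rule has_sum_unique[OF iffD1[OF has_sum_cong[OF eq] lhs] rhs])
  thus ?thesis by simp
qed

text \<open>Ramanujan's formula with alpha = pi a and beta = pi/a. The terms k = 1, ..., n of the
  Bernoulli sum come from \<open>lattice_sum_reciprocity\<close>, the end terms k = 0 and k = n + 1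
  from zeta(2n+2).\<close>

theorem ramanujan_reciprocity:
  assumes a: "Re a > 0" and n: "n \<ge> 1"
  shows "coth_sum n a - (- (a\<^sup>2)) ^ n * coth_sum n (1 / a) =
     (-1) ^ n * of_real ((2 * pi) ^ (2 * n + 1)) / a *
       (\<Sum>k\<le>n+1. (- (a\<^sup>2)) ^ k * of_real (bcoeff (2 * k) * bcoeff (2 * n + 2 - 2 * k)))"
proof -
  have a0: "a \<noteq> 0" using a by auto
  define P where "P = complex_of_real ((2 * pi) ^ (2 * n + 2))"
  define x where "x = - (a\<^sup>2)"
  define b where "b = (\<lambda>k. complex_of_real (bcoeff (2 * k)))"
  have z: "zeta_nat (2 * k) = - ((-1) ^ k) * of_real ((2 * pi) ^ (2 * k)) * b k / 2" if "k \<ge> 1" for k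
    using zeta_nat_even[OF that] by (simp add: b_def)
  have zz: "zeta_nat (2 * (n - i)) * zeta_nat (2 * (i + 1)) =
      - ((-1) ^ n) * P / 4 * (b (Suc i) * b (n - i))" if "i < n" for i
  proof -
    have e: "n - i \<ge> 1" "i + 1 \<ge> 1" using that by auto
    have s: "(-1 :: complex) ^ (n - i) * (-1) ^ (i + 1) = - ((-1) ^ n)"
      using that by (simp flip: power_add)
    have p: "complex_of_real ((2 * pi) ^ (2 * (n - i))) * of_real ((2 * pi) ^ (2 * (i + 1))) = P"
    proof -
      have "2 * (n - i) + 2 * (i + 1) = 2 * n + 2" using that by simp
      thus ?thesis unfolding P_def of_real_mult[symmetric] power_add[symmetric] by (simp only:)
    qed
    have "zeta_nat (2 * (n - i)) * zeta_nat (2 * (i + 1)) =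
      ((-1) ^ (n - i) * (-1) ^ (i + 1)) *
       (of_real ((2 * pi) ^ (2 * (n - i))) * of_real ((2 * pi) ^ (2 * (i + 1)))) / 4 * (b (Suc i) * b (n - i))"
      unfolding z[OF e(1)] z[OF e(2)] by simp
    thus ?thesis unfolding s p .
  qed
  have zn: "zeta_nat (2 * n + 2) = (-1) ^ n * P / 2 * b (Suc n)"
    using z[of "Suc n"] by (simp add: P_def)
  have b0: "b 0 = 1" by (simp add: b_def bcoeff_0)
  have Re': "Re (1 / a) > 0" by (rule Re_inverse_pos) fact
  have "of_real pi * (coth_sum n a - x ^ n * coth_sum n (1 / a)) =
     2 * a * lattice_sum n a + zeta_nat (2 * n + 2) / a
      - x ^ n * (2 * (1 / a) * lattice_sum n (1 / a) + zeta_nat (2 * n + 2) / (1 / a))"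
    using coth_sum_has_sum(2)[OF a n] coth_sum_has_sum(2)[OF Re' n]
    by (simp only: right_diff_distrib mult.left_commute[of "of_real pi" "x ^ n"])
  also have "\<dots> = 2 * a * (lattice_sum n a - x ^ n * (lattice_sum n (1 / a) / a\<^sup>2)) +
      (zeta_nat (2 * n + 2) / a) * (1 - x ^ n * a\<^sup>2)"
    using a0 by (simp add: field_simps power2_eq_square)
  also have "lattice_sum n a - x ^ n * (lattice_sum n (1 / a) / a\<^sup>2) =
      (\<Sum>i<n. x ^ i * (- ((-1) ^ n) * P / 4 * (b (Suc i) * b (n - i))))"
    unfolding x_def lattice_sum_reciprocity[OF a n] by (intro sum.cong refl) (simp only: zz lessThan_iff)
  also have "\<dots> = (- ((-1) ^ n) * P / 4) * (\<Sum>i<n. x ^ i * (b (Suc i) * b (n - i)))"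
    by (simp only: sum_distrib_left mult_ac)
  \<comment> \<open>Because x = -a^2, the factor -a/2 equals x/(2 a). This raises every power of x
    by one and gives the prefactor shared with the end terms.\<close>
  also have "2 * a * \<dots> = (-1) ^ n * P / (2 * a) * (\<Sum>i<n. x ^ Suc i * (b (Suc i) * b (n - i)))"
    using a0 by (simp add: x_def sum_distrib_left[symmetric] mult.assoc sum_negf power2_eq_square)
  also have "zeta_nat (2 * n + 2) / a * (1 - x ^ n * a\<^sup>2) =
      (-1) ^ n * P / (2 * a) * (b (Suc n) + x ^ Suc n * b (Suc n))"
  proof -
    have "1 - x ^ n * a\<^sup>2 = 1 + x ^ Suc n" by (simp add: x_def)
    moreover have "q / 2 * c / a * (1 + y) = q / (2 * a) * (c + y * c)" for q c y
      using a0 by (simp add: field_simps)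
    ultimately show ?thesis unfolding zn by (simp only:)
  qed
  also have "(-1) ^ n * P / (2 * a) * (\<Sum>i<n. x ^ Suc i * (b (Suc i) * b (n - i))) +
      (-1) ^ n * P / (2 * a) * (b (Suc n) + x ^ Suc n * b (Suc n)) =
      (-1) ^ n * P / (2 * a) * (\<Sum>k\<le>Suc n. x ^ k * (b k * b (Suc n - k)))"
  proof -
    have "(\<Sum>k\<le>Suc n. x ^ k * (b k * b (Suc n - k))) =
        b (Suc n) + (\<Sum>k\<le>n. x ^ Suc k * (b (Suc k) * b (n - k)))"
      by (subst sum.atMost_Suc_shift) (simp add: b0)
    also have "(\<Sum>k\<le>n. x ^ Suc k * (b (Suc k) * b (n - k))) =
        (\<Sum>k<n. x ^ Suc k * (b (Suc k) * b (n - k))) + x ^ Suc n * b (Suc n)"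
      by (simp add: b0 flip: lessThan_Suc_atMost)
    finally show ?thesis by (simp only: distrib_left add_ac)
  qed
  also have "(\<Sum>k\<le>Suc n. x ^ k * (b k * b (Suc n - k))) =
     (\<Sum>k\<le>n+1. (- (a\<^sup>2)) ^ k * of_real (bcoeff (2 * k) * bcoeff (2 * n + 2 - 2 * k)))"
    by (simp add: x_def b_def diff_mult_distrib2)
  also have "(-1) ^ n * P / (2 * a) = of_real pi * ((-1) ^ n * of_real ((2 * pi) ^ (2 * n + 1)) / a)"
    by (simp add: P_def)
  finally show ?thesis unfolding x_def by (simp only: mult.assoc mult_cancel_left) auto
qed

section \<open>The two linear relations\<close>

lemma zeta_has_sum:
  assumes "N \<ge> 2"
  shows "((\<lambda>k. 1 / real k ^ N) has_sum zeta (real N)) {1..}"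
proof -
  have s: "(\<lambda>k. 1 / real k ^ N) summable_on {1..}"
    using abs_summable_inverse_powers[OF assms, where 'a = real] by simp
  have "((\<lambda>k. 1 / real (Suc k) ^ N) has_sum (\<Sum>\<^sub>\<infinity>k\<in>{1..}. 1 / real k ^ N)) UNIV"
    using has_sum_infsum[OF s] by (simp only: has_sum_atLeast_1_iff)
  from has_sum_imp_sums[OF this] have "(\<Sum>\<^sub>\<infinity>k\<in>{1..}. 1 / real k ^ N) = zeta (real N)"
    unfolding zeta_def by (simp add: sums_iff powr_realpow del: of_nat_Suc)
  thus ?thesis using has_sum_infsum[OF s] by simp
qed

lemma S_sum_has_sum:
  assumes "N \<ge> 2" "r > 0"
  shows "((\<lambda>k. 1 / (real k ^ N * (exp (pi * r * real k) - 1))) has_sum S_sum N r) {1..}"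
proof -
  let ?f = "\<lambda>k. 1 / (real k ^ N * (exp (pi * r * real k) - 1))"
  have "(\<lambda>k. 1 / (pi * r) * (1 / real k ^ N)) summable_on {1..}"
    by (rule summable_on_cmult_right) (use zeta_has_sum[OF assms(1)] in \<open>auto simp: summable_on_def\<close>)
  hence s: "?f summable_on {1..}"
  proof (rule summable_on_comparison_test)
    fix k :: nat assume k: "k \<in> {1..}"
    \<comment> \<open>By e^t - 1 >= t, the exponential factor is bounded below by the constant pi r,
      which suffices for comparison with the series of 1/k^N.\<close>
    have "pi * r * 1 \<le> pi * r * real k" using k assms(2) by (intro mult_left_mono) auto
    also have "\<dots> \<le> exp (pi * r * real k) - 1" using exp_ge_add_one_self[of "pi * r * real k"] by linarith
    finally have *: "pi * r \<le> exp (pi * r * real k) - 1" by simp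
    moreover have "pi * r > 0" using assms(2) by simp
    ultimately have "1 / (exp (pi * r * real k) - 1) \<le> 1 / (pi * r)" by (simp only: frac_le zero_le_one order_refl)
    hence "1 / real k ^ N * (1 / (exp (pi * r * real k) - 1)) \<le> 1 / real k ^ N * (1 / (pi * r))"
      by (intro mult_left_mono) auto
    thus "?f k \<le> 1 / (pi * r) * (1 / real k ^ N)" by (simp add: mult_ac)
    show "0 \<le> ?f k" using * \<open>pi * r > 0\<close> by auto
  qed
  have "((\<lambda>k. ?f (Suc k)) has_sum (\<Sum>\<^sub>\<infinity>k\<in>{1..}. ?f k)) UNIV"
    using has_sum_infsum[OF s] by (simp only: has_sum_atLeast_1_iff)
  from has_sum_imp_sums[OF this] have "(\<Sum>\<^sub>\<infinity>k\<in>{1..}. ?f k) = S_sum N r"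
    unfolding S_sum_def by (simp add: sums_iff del: of_nat_Suc)
  thus ?thesis using has_sum_infsum[OF s] by simp
qed

lemma S_sum_pos:
  assumes "N \<ge> 2" "r > 0"
  shows "S_sum N r > 0"
proof (rule has_sum_strict_mono[OF has_sum_0 S_sum_has_sum[OF assms], where x = 1])
  show "0 \<le> 1 / (real k ^ N * (exp (pi * r * real k) - 1))" if "k \<in> {1..}" for k
    using assms(2) by simp
  show "0 < 1 / (real 1 ^ N * (exp (pi * r * real 1) - 1))" using assms(2) by simp
qed auto

lemma zeta_pos:
  assumes "N \<ge> 2"
  shows "zeta (real N) > 0"
  by (rule has_sum_strict_mono[OF has_sum_0 zeta_has_sum[OF assms], where x = 1]) auto

text \<open>Termwise from e^2 - 1 = (e - 1)(e + 1) >= 2 (e - 1), where e = e^(pi r k) > 1. This is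
  the decrease in r that later keeps the denominator of the final formula away from 0.\<close>

lemma S_sum_double:
  assumes "N \<ge> 2" "r > 0"
  shows "2 * S_sum N (2 * r) \<le> S_sum N r"
proof (rule has_sum_mono[OF has_sum_cmult_right[OF S_sum_has_sum] S_sum_has_sum])
  fix k :: nat assume k: "k \<in> {1..}"
  define e where "e = exp (pi * r * real k)"
  have e: "e > 1" "exp (pi * (2 * r) * real k) = e\<^sup>2"
    using k assms by (simp_all add: e_def exp_double[symmetric] mult_ac)
  have "e\<^sup>2 - 1 = (e - 1) * (e + 1)" by (simp add: algebra_simps power2_eq_square)
  also have "\<dots> \<ge> (e - 1) * 2" using e by (intro mult_left_mono) auto
  finally have "2 * (e - 1) \<le> e\<^sup>2 - 1" by simp
  hence "2 * (1 / (e\<^sup>2 - 1)) \<le> 1 / (e - 1)" using e by (simp add: field_simps)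
  hence "1 / real k ^ N * (2 * (1 / (e\<^sup>2 - 1))) \<le> 1 / real k ^ N * (1 / (e - 1))"
    by (intro mult_left_mono) auto
  thus "2 * (1 / (real k ^ N * (exp (pi * (2 * r) * real k) - 1))) \<le> 1 / (real k ^ N * (exp (pi * r * real k) - 1))"
    unfolding e(2) e_def[symmetric] by simp
qed (use assms in auto)

section \<open>Evaluation of the coth sums at a = r/2, 1 - i and (1 + i)/2\<close>

text \<open>At all points needed, even the non-real ones, coth(pi a k) is real for every k >= 1, so
  the complex sum reduces to a real one.\<close>

lemma coth_sum_eqI:
  assumes "((\<lambda>k. f k / real k ^ (2 * n + 1)) has_sum s) {1..}"
  assumes "\<And>k. k \<ge> 1 \<Longrightarrow> 1 + 2 / (exp (2 * of_real pi * (a * of_nat k)) - 1) = complex_of_real (f k)"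
  shows "coth_sum n a = of_real s"
proof -
  have "((\<lambda>k. complex_of_real (f k / real k ^ (2 * n + 1))) has_sum of_real s) {1..}"
    by (rule has_sum_of_real) fact
  also have "?this \<longleftrightarrow> ((\<lambda>k. (1 + 2 / (exp (2 * of_real pi * (a * of_nat k)) - 1)) / of_nat k ^ (2 * n + 1)) has_sum of_real s) {1..}"
    by (rule has_sum_cong) (simp add: assms(2))
  finally show ?thesis unfolding coth_sum_def by (rule infsumI)
qed

lemma zeta_plus_S_sum_has_sum:
  assumes "n \<ge> 1" "r > 0"
  shows "((\<lambda>k. (1 + 2 / (exp (pi * r * real k) - 1)) / real k ^ (2 * n + 1)) has_sum
           (zeta (real (2 * n + 1)) + 2 * S_sum (2 * n + 1) r)) {1..}"
proof -
  have "((\<lambda>k. 1 / real k ^ (2 * n + 1) + 2 * (1 / (real k ^ (2 * n + 1) * (exp (pi * r * real k) - 1)))) has_sum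
           (zeta (real (2 * n + 1)) + 2 * S_sum (2 * n + 1) r)) {1..}"
    using assms by (intro has_sum_add has_sum_cmult_right zeta_has_sum S_sum_has_sum) auto
  also have "(\<lambda>k. 1 / real k ^ (2 * n + 1) + 2 * (1 / (real k ^ (2 * n + 1) * (exp (pi * r * real k) - 1)))) =
     (\<lambda>k. (1 + 2 / (exp (pi * r * real k) - 1)) / real k ^ (2 * n + 1))"
    by (simp add: add_divide_distrib mult.commute)
  finally show ?thesis .
qed

text \<open>The exponent is 2 pi a k in \<open>coth_sum\<close> but pi r k in \<open>S_sum\<close>,
  hence a = r/2.\<close>

lemma coth_sum_real:
  assumes "n \<ge> 1" "r > 0"
  shows "coth_sum n (of_real (r / 2)) = of_real (zeta (real (2 * n + 1)) + 2 * S_sum (2 * n + 1) r)"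
  by (rule coth_sum_eqI[OF zeta_plus_S_sum_has_sum[OF assms]]) (simp add: mult_ac flip: exp_of_real)

lemma exp_pi_i_nat: "exp (\<i> * of_real pi * of_nat k) = (-1) ^ k"
proof -
  have "exp (\<i> * of_real pi * of_nat k) = exp (\<i> * of_real pi) ^ k"
    by (simp add: exp_of_nat2_mult)
  thus ?thesis by simp
qed

text \<open>The imaginary part of a = 1 - i contributes only e^(-2 pi i k) = 1, so the value is the
  one at a = 1.\<close>

lemma coth_sum_1_minus_i:
  assumes "n \<ge> 1"
  shows "coth_sum n (1 - \<i>) = of_real (zeta (real (2 * n + 1)) + 2 * S_sum (2 * n + 1) 2)"
proof (rule coth_sum_eqI[OF zeta_plus_S_sum_has_sum[OF assms]])
  fix k :: nat
  have "2 * of_real pi * ((1 - \<i>) * of_nat k) =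
     of_real (2 * pi * real k) - 2 * (\<i> * of_real pi * of_nat k)"
    by (simp add: algebra_simps)
  hence "exp (2 * of_real pi * ((1 - \<i>) * of_nat k)) =
     exp (of_real (2 * pi * real k)) / exp (\<i> * of_real pi * of_nat k) ^ 2"
    by (simp only: exp_diff exp_double)
  also have "exp (\<i> * of_real pi * of_nat k) ^ 2 = 1"
    unfolding exp_pi_i_nat by (simp flip: power_mult)
  finally show "1 + 2 / (exp (2 * of_real pi * ((1 - \<i>) * of_nat k)) - 1) =
     complex_of_real (1 + 2 / (exp (pi * 2 * real k) - 1))"
    by (simp add: mult_ac flip: exp_of_real)
qed simp

lemma has_sum_even:
  assumes "((\<lambda>l. f (2 * l)) has_sum s) {1..}"
  shows "((\<lambda>k::nat. if even k then f k else 0) has_sum s) {1..}"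
proof -
  have "(f has_sum s) ((\<lambda>l. 2 * l) ` {1..})"
    using assms by (subst has_sum_reindex) (auto simp: inj_on_def o_def)
  also have "?this \<longleftrightarrow> ?thesis"
    by (rule has_sum_cong_neutral) (auto elim!: evenE simp: image_iff)
  finally show ?thesis .
qed

text \<open>Here e^(2 pi a k) = (-1)^k e with e = e^(pi k). For odd k, -1/(e + 1) = -1/(e - 1) +
  2/(e^2 - 1) leads back to terms of S(1) and S(2). This expression is used for all k and corrected
  at even k by 4 times the difference of the terms of S(1) and S(2); over even k these sum to
  S(2)/2^N and S(4)/2^N.\<close>

lemma coth_sum_half_1_plus_i:
  assumes "n \<ge> 1"
  defines "N \<equiv> 2 * n + 1"
  shows "coth_sum n ((1 + \<i>) / 2) =
    of_real (zeta (real N) + 2 * (2 * S_sum N 2 - S_sum N 1 + 2 / 2 ^ N * (S_sum N 2 - S_sum N 4)))"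
proof (rule coth_sum_eqI)
  have N: "N \<ge> 2" using assms by (simp add: N_def)
  let ?e = "\<lambda>r k. 1 / (exp (pi * r * real k) - 1)"
  let ?S = "\<lambda>r k. 1 / (real k ^ N * (exp (pi * r * real k) - 1))"
  let ?d = "\<lambda>k. ?S 1 k - ?S 2 k"
  have "((\<lambda>l. 1 / 2 ^ N * (?S 2 l + (-1) * ?S 4 l)) has_sum (1 / 2 ^ N * (S_sum N 2 + (-1) * S_sum N 4))) {1..}"
    by (intro has_sum_cmult_right has_sum_add S_sum_has_sum N) auto
  also have "(\<lambda>l. 1 / 2 ^ N * (?S 2 l + (-1) * ?S 4 l)) = (\<lambda>l. ?d (2 * l))"
    by (rule ext) (simp add: power_mult_distrib right_diff_distrib mult_ac)
  finally have "((\<lambda>k. if even k then ?d k else 0) has_sum (1 / 2 ^ N * (S_sum N 2 + (-1) * S_sum N 4))) {1..}"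
    by (rule has_sum_even)
  hence "((\<lambda>k. (1 / real k ^ N + ((-2) * ?S 1 k + 4 * ?S 2 k)) + 4 * (if even k then ?d k else 0)) has_sum
     ((zeta (real N) + ((-2) * S_sum N 1 + 4 * S_sum N 2)) + 4 * (1 / 2 ^ N * (S_sum N 2 + (-1) * S_sum N 4)))) {1..}"
    by (intro has_sum_add has_sum_cmult_right zeta_has_sum S_sum_has_sum N) auto
  also have "(\<lambda>k. (1 / real k ^ N + ((-2) * ?S 1 k + 4 * ?S 2 k)) + 4 * (if even k then ?d k else 0)) =
      (\<lambda>k. (if even k then 1 + 2 * ?e 1 k else 1 - 2 * ?e 1 k + 4 * ?e 2 k) / real k ^ N)"
    by (rule ext) (simp add: add_divide_distrib diff_divide_distrib mult.commute)
  also have "(zeta (real N) + ((-2) * S_sum N 1 + 4 * S_sum N 2)) + 4 * (1 / 2 ^ N * (S_sum N 2 + (-1) * S_sum N 4)) =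
     zeta (real N) + 2 * (2 * S_sum N 2 - S_sum N 1 + 2 / 2 ^ N * (S_sum N 2 - S_sum N 4))"
    by (simp add: algebra_simps)
  finally show "((\<lambda>k. (if even k then 1 + 2 * ?e 1 k else 1 - 2 * ?e 1 k + 4 * ?e 2 k) / real k ^ (2 * n + 1)) has_sum
     (zeta (real N) + 2 * (2 * S_sum N 2 - S_sum N 1 + 2 / 2 ^ N * (S_sum N 2 - S_sum N 4)))) {1..}"
    unfolding N_def .
  fix k :: nat assume k: "k \<ge> 1"
  define e where "e = exp (pi * real k)"
  have e: "e > 1" "exp (pi * 2 * real k) = e\<^sup>2"
    using k by (simp_all add: e_def exp_double[symmetric] mult_ac)
  have "2 * of_real pi * ((1 + \<i>) / 2 * of_nat k) =
     of_real (pi * real k) + \<i> * of_real pi * of_nat k"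
    by (simp add: field_simps)
  hence "exp (2 * of_real pi * ((1 + \<i>) / 2 * of_nat k)) =
     exp (of_real (pi * real k)) * exp (\<i> * of_real pi * of_nat k)"
    by (simp only: exp_add)
  also have "\<dots> = of_real (e * (-1) ^ k)"
    unfolding exp_pi_i_nat by (simp add: e_def flip: exp_of_real)
  finally have "1 + 2 / (exp (2 * of_real pi * ((1 + \<i>) / 2 * of_nat k)) - 1) =
     complex_of_real (1 + 2 / (e * (-1) ^ k - 1))" by simp
  also have "1 + 2 / (e * (-1) ^ k - 1) =
      (if even k then 1 + 2 * ?e 1 k else 1 - 2 * ?e 1 k + 4 * ?e 2 k)"
  proof (cases "even k")
    case False
    have "e\<^sup>2 - 1 = (e - 1) * (e + 1)" by (simp add: algebra_simps power2_eq_square)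
    hence "1 + 2 / (- e - 1) = 1 - 2 * (1 / (e - 1)) + 4 * (1 / (e\<^sup>2 - 1))"
      using e(1) by (simp add: divide_simps) (simp add: algebra_simps)
    thus ?thesis using False e(2) by (simp add: e_def)
  qed (simp add: e_def)
  finally show "1 + 2 / (exp (2 * of_real pi * ((1 + \<i>) / 2 * of_nat k)) - 1) =
     complex_of_real (if even k then 1 + 2 * ?e 1 k else 1 - 2 * ?e 1 k + 4 * ?e 2 k)" .
qed

text \<open>Ramanujan's formula with n = 2m at a = 2: since -(a^2) = -4, its Bernoulli sum is
  \<open>G_coeff (2 * m)\<close> itself, and a = 2, 1/a = 1/2 give S(4) and S(1).\<close>

lemma zeta_S_sum_relation_1_4:
  assumes "m \<ge> 1"
  defines "N \<equiv> 4 * m + 1"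
  shows "(zeta (real N) + 2 * S_sum N 4) - 16 ^ m * (zeta (real N) + 2 * S_sum N 1) =
           (2 * pi) ^ N / 2 * G_coeff (2 * m)"
proof -
  have n: "2 * m \<ge> 1" and N: "2 * (2 * m) + 1 = N" using assms by simp_all
  have c: "coth_sum (2 * m) 2 = of_real (zeta (real N) + 2 * S_sum N 4)"
    using coth_sum_real[OF n, of 4, unfolded N] by simp
  have c': "coth_sum (2 * m) (1 / 2) = of_real (zeta (real N) + 2 * S_sum N 1)"
    using coth_sum_real[OF n, of 1, unfolded N] by simp
  have G: "(\<Sum>k\<le>2*m+1. (- (2\<^sup>2)) ^ k * of_real (bcoeff (2 * k) * bcoeff (2 * (2 * m) + 2 - 2 * k))) =
     complex_of_real (G_coeff (2 * m))"
    unfolding G_coeff_def bcoeff_def by (simp add: atMost_atLeast0)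
  have q: "(- (2\<^sup>2)) ^ (2 * m) = complex_of_real (16 ^ m)" by (simp add: power_mult)
  have "coth_sum (2 * m) 2 - (- (2\<^sup>2)) ^ (2 * m) * coth_sum (2 * m) (1 / 2) =
     (-1) ^ (2 * m) * of_real ((2 * pi) ^ (2 * (2 * m) + 1)) / 2 * of_real (G_coeff (2 * m))"
    unfolding G[symmetric] by (rule ramanujan_reciprocity) (use n in auto)
  hence "complex_of_real ((zeta (real N) + 2 * S_sum N 4) - 16 ^ m * (zeta (real N) + 2 * S_sum N 1)) =
     of_real ((2 * pi) ^ N / 2 * G_coeff (2 * m))"
    unfolding c c' q N by simp
  thus ?thesis by (simp only: of_real_eq_iff)
qed

lemma sum_even_atMost_odd:
  fixes f :: "nat \<Rightarrow> 'a::comm_monoid_add"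
  assumes "\<And>k. odd k \<Longrightarrow> f k = 0"
  shows "(\<Sum>k\<le>2*m+1. f k) = (\<Sum>l\<le>m. f (2 * l))"
  using assms by (induction m) auto

text \<open>Ramanujan's formula with n = 2m at a = 1 - i, where -(a^2) = 2i and (2i)^(2m) = (-4)^m.
  The relation is multiplied by (-4)^m, which produces 16^m on the left and the powers
  \<open>(-4) ^ (n+k)\<close> of \<open>H_coeff\<close> on the right.\<close>

lemma zeta_S_sum_relation_1_2_4:
  assumes "m \<ge> 1"
  defines "N \<equiv> 4 * m + 1"
  shows "(-4) ^ m * (zeta (real N) + 2 * S_sum N 2) -
           16 ^ m * (zeta (real N) + 2 * (2 * S_sum N 2 - S_sum N 1 + 1 / 16 ^ m * (S_sum N 2 - S_sum N 4))) =
           (2 * pi) ^ N * H_coeff m"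
proof -
  have n: "2 * m \<ge> 1" and N: "2 * (2 * m) + 1 = N" using assms by simp_all
  define b where "b = (\<lambda>k. bcoeff (2 * k) * bcoeff (2 * (2 * m) + 2 - 2 * k))"
  define \<Sigma> where "\<Sigma> = (\<Sum>k\<le>2*m+1. (2 * \<i>) ^ k * of_real (b k))"
  define Z2 where "Z2 = zeta (real N) + 2 * S_sum N 2"
  define T where "T = zeta (real N) + 2 * (2 * S_sum N 2 - S_sum N 1 + 2 / 2 ^ N * (S_sum N 2 - S_sum N 4))"
  have sq: "- ((1 - \<i>)\<^sup>2) = 2 * \<i>" by (simp add: power2_eq_square algebra_simps)
  have inv: "1 / (1 - \<i>) = (1 + \<i>) / 2" by (simp add: complex_eq_iff Re_divide Im_divide)
  have p: "(2 * \<i>) ^ (2 * m) = of_real ((-4) ^ m)" by (simp add: power_mult power_mult_distrib)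
  have "coth_sum (2 * m) (1 - \<i>) - (2 * \<i>) ^ (2 * m) * coth_sum (2 * m) (1 / (1 - \<i>)) =
     (-1) ^ (2 * m) * of_real ((2 * pi) ^ (2 * (2 * m) + 1)) / (1 - \<i>) * \<Sigma>"
    unfolding \<Sigma>_def b_def sq[symmetric] by (rule ramanujan_reciprocity) (use n in auto)
  moreover have "coth_sum (2 * m) (1 - \<i>) = of_real Z2"
    using coth_sum_1_minus_i[OF n, unfolded N] by (simp only: Z2_def)
  moreover have "coth_sum (2 * m) (1 / (1 - \<i>)) = of_real T"
    using coth_sum_half_1_plus_i[OF n, unfolded N] by (simp only: T_def inv)
  moreover have "x / (1 - \<i>) = x * ((1 + \<i>) / 2)" for x
    using inv by (metis divide_inverse inverse_eq_divide)
  ultimately have eq: "of_real (Z2 - (-4) ^ m * T) = of_real ((2 * pi) ^ N) * ((1 + \<i>) / 2) * \<Sigma>"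
    unfolding N p by simp
  \<comment> \<open>The left-hand side is real, which determines \<open>\<Sigma>\<close> up to its real part, the sum over even \<open>k\<close>.\<close>
  have "Im (of_real ((2 * pi) ^ N) * ((1 + \<i>) / 2) * \<Sigma>) = 0"
    unfolding eq[symmetric] by (rule Im_complex_of_real)
  moreover have "Im (of_real c * ((1 + \<i>) / 2) * \<Sigma>) = c / 2 * (Re \<Sigma> + Im \<Sigma>)" for c
    by (simp add: algebra_simps add_divide_distrib)
  ultimately have "(2 * pi) ^ N / 2 * (Re \<Sigma> + Im \<Sigma>) = 0" by (simp only:)
  hence Im: "Im \<Sigma> = - Re \<Sigma>" by (simp add: add_eq_0_iff2)
  have "Z2 - (-4) ^ m * T = Re (of_real ((2 * pi) ^ N) * ((1 + \<i>) / 2) * \<Sigma>)"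
    unfolding eq[symmetric] by (rule Re_complex_of_real[symmetric])
  also have "Re (of_real c * ((1 + \<i>) / 2) * \<Sigma>) = c / 2 * (Re \<Sigma> - Im \<Sigma>)" for c
    by (simp add: algebra_simps diff_divide_distrib)
  finally have Re: "Z2 - (-4) ^ m * T = (2 * pi) ^ N * Re \<Sigma>" by (simp add: Im)
  have "Re \<Sigma> = (\<Sum>k\<le>2*m+1. Re ((2 * \<i>) ^ k) * b k)"
    unfolding \<Sigma>_def by simp
  \<comment> \<open>Odd powers of 2i are purely imaginary and drop out of the real part.\<close>
  also have "\<dots> = (\<Sum>l\<le>m. Re ((2 * \<i>) ^ (2 * l)) * b (2 * l))"
    by (rule sum_even_atMost_odd) (auto elim!: oddE simp: power_mult power_mult_distrib Re_power_real)
  also have "\<dots> = (\<Sum>l\<le>m. (-4) ^ l * b (2 * l))"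
  proof -
    have "(2 * \<i>) ^ (2 * l) = of_real ((-4) ^ l)" for l by (simp add: power_mult power_mult_distrib)
    thus ?thesis by (simp only: Re_complex_of_real)
  qed
  finally have "(-4) ^ m * Re \<Sigma> = H_coeff m"
    unfolding H_coeff_def b_def bcoeff_def
    by (simp add: sum_distrib_left power_add mult_ac atMost_atLeast0)
  moreover have "(-4) ^ m * Z2 - 16 ^ m * T = (-4) ^ m * (Z2 - (-4) ^ m * T)"
    by (simp add: right_diff_distrib flip: mult.assoc power_mult_distrib)
  ultimately have "(-4) ^ m * Z2 - 16 ^ m * T = (2 * pi) ^ N * H_coeff m"
    unfolding Re by (metis mult.left_commute)
  moreover have "2 / 2 ^ N = 1 / (16 :: real) ^ m"
    by (simp add: N_def power_mult)
  ultimately show ?thesis unfolding Z2_def T_def by simp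
qed

section \<open>Elimination of the power of pi and nonvanishing of the denominator\<close>

text \<open>Here \<open>q = 16\<^sup>m\<close>, \<open>p = (-4)\<^sup>m\<close>, \<open>c = (2 \<pi>)\<^bsup>4m+1\<^esup>\<close>, \<open>Z = \<zeta>(4m+1)\<close> and \<open>s\<^sub>r = S(r)\<close>.\<close>

lemma zeta_by_elimination:
  fixes q p c G H K E Z s1 s2 s4 :: real
  assumes q: "q \<ge> 16" and p: "\<bar>p\<bar> \<le> q / 4" and c: "c > 0"
    and pos: "Z > 0" "s2 > 0" "s4 > 0" and dbl: "2 * s2 \<le> s1" "2 * s4 \<le> s2"
    and R1: "(Z + 2 * s4) - q * (Z + 2 * s1) = c / 2 * G"
    and R2: "p * (Z + 2 * s2) - q * (Z + 2 * (2 * s2 - s1 + 1 / q * (s2 - s4))) = c * H"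
    and K: "K = 1 / 2 * (1 - q) / (1 + p - 2 * q)"
    and E: "E = q / 2 * G - 2 * q * K * H - q * K * G"
  shows "Z = - (q * (2 * E - q * G)) / ((q - 1) * E) * s1
             - (2 * q * G * K * (2 * q - p + 1)) / ((q - 1) * E) * s2
             - (q * G * (1 - 4 * K) - 2 * E) / ((q - 1) * E) * s4"
proof -
  \<comment> \<open>The coefficient of Z in 2 H times the left side of \<open>R1\<close> minus G
    times that of \<open>R2\<close>, the combination in which c disappears.\<close>
  define W where "W = 2 * H * (1 - q) - G * (p - q)"
  have D: "1 + p - 2 * q \<noteq> 0" using q p by linarith
  have K0: "K \<noteq> 0" using D q by (simp add: K)
  have KD: "2 * K * (1 + p - 2 * q) = 1 - q"
  proof -
    have "2 * (1 / 2 * x / y) * y = x" if "y \<noteq> 0" for x y :: real using that by simp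
    thus ?thesis unfolding K using D .
  qed
  have R2': "p * (Z + 2 * s2) - q * Z - 4 * q * s2 + 2 * q * s1 - 2 * (s2 - s4) = c * H"
  proof -
    have "q * (Z + 2 * (2 * s2 - s1 + 1 / q * (s2 - s4))) =
        q * Z + 4 * q * s2 - 2 * q * s1 + 2 * (q * (1 / q)) * (s2 - s4)" by (simp only: algebra_simps)
    also have "q * (1 / q) = 1" using q by simp
    finally show ?thesis using R2 by linarith
  qed
  \<comment> \<open>Both sides equal c^2 G H; the common factor c > 0 is then cancelled.\<close>
  have "c * (2 * H * ((Z + 2 * s4) - q * (Z + 2 * s1))) =
        c * (G * (p * (Z + 2 * s2) - q * Z - 4 * q * s2 + 2 * q * s1 - 2 * (s2 - s4)))"
    unfolding R1 R2' by simp
  hence "2 * H * ((Z + 2 * s4) - q * (Z + 2 * s1)) =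
        G * (p * (Z + 2 * s2) - q * Z - 4 * q * s2 + 2 * q * s1 - 2 * (s2 - s4))"
    using c by simp
  hence ZW: "Z * W = (2 * q * G + 4 * q * H) * s1 + G * (2 * p - 4 * q - 2) * s2 + (2 * G - 4 * H) * s4"
    by (simp add: W_def algebra_simps)
  \<comment> \<open>The value of K is what makes E proportional to W: it satisfies 2 K (1 + p - 2 q)
    = 1 - q. As K is nonzero, it remains to show that W is nonzero.\<close>
  have EW: "(q - 1) * E = q * K * W"
  proof -
    have "(q - 1) * E - q * K * W = q * G / 2 * ((q - 1) + 2 * K * (1 + p - 2 * q))"
      unfolding E W_def by (simp add: field_simps)
    thus ?thesis unfolding KD by simp
  qed
  \<comment> \<open>If \<open>G = 0\<close>, the first relation would equate a negative number with 0.\<close>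
  have G0: "G \<noteq> 0"
  proof
    assume "G = 0"
    hence "Z + 2 * s4 = q * Z + 2 * (q * s1)" using R1 by (simp add: algebra_simps)
    moreover have "1 * s4 \<le> q * s1" "1 * Z < q * Z"
      using q dbl pos by (intro mult_mono mult_strict_right_mono; simp)+
    ultimately show False by simp
  qed
  \<comment> \<open>If \<open>W = 0\<close>, then \<open>Z\<close> drops out of \<open>ZW\<close>; what is left is impossible because
    \<open>H\<close> is then close to \<open>G / 2\<close> and \<open>s1\<close> is much larger than \<open>s2\<close> and \<open>s4\<close>.\<close>
  have W0: "W \<noteq> 0"
  proof
    assume W: "W = 0"
    define h where "h = 2 * H / G"
    have H: "2 * H = h * G" using G0 by (simp add: h_def)
    have "G * (h * (q - 1)) = G * (q - p)" using W unfolding W_def H by (simp add: algebra_simps)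
    hence h: "h * (q - 1) = q - p" using G0 by simp
    have "G * (2 * q * (1 + h) * s1 + (2 * p - 4 * q - 2) * s2 + 2 * (1 - h) * s4) =
          (2 * q * G + 2 * q * (2 * H)) * s1 + G * (2 * p - 4 * q - 2) * s2 + (2 * G - 2 * (2 * H)) * s4"
      unfolding H by (simp add: algebra_simps)
    also have "\<dots> = 0" using ZW W by (simp add: mult.assoc)
    finally have "2 * q * (1 + h) * s1 + (2 * p - 4 * q - 2) * s2 + 2 * (1 - h) * s4 = 0"
      using G0 by simp
    hence 0: "q * (1 + h) * s1 + (1 - h) * s4 = (2 * q + 1 - p) * s2"
      by (simp add: algebra_simps)
    \<comment> \<open>From |p| <= q/4, h = (q - p)/(q - 1) lies between 3/4 and 5/4 times q/(q - 1).
      As q >= 16, this ratio is at most 16/15, which yields the upper bound 4/3.\<close>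
    have h1: "h \<ge> 3 / 4"
    proof (rule ccontr)
      assume "\<not> h \<ge> 3 / 4"
      hence "h * (q - 1) < 3 / 4 * (q - 1)" using q by (intro mult_strict_right_mono) auto
      thus False unfolding h using p q by (simp add: abs_le_iff)
    qed
    have h2: "h \<le> 4 / 3"
    proof (rule ccontr)
      assume "\<not> h \<le> 4 / 3"
      hence "h * (q - 1) > 4 / 3 * (q - 1)" using q by (intro mult_strict_right_mono) auto
      thus False unfolding h using p q by (simp add: abs_le_iff)
    qed
    \<comment> \<open>In the equation \<open>0\<close> the left side is at least 7/2 q s2 - s4/3 and
      the right side at most 9/4 q s2 + s2. The gap 5/4 q s2 >= 20 s2 exceeds s2 + s4/3 because s4
      <= s2/2.\<close>
    have "q * (7 / 4) * (2 * s2) \<le> q * (1 + h) * s1"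
      using q h1 dbl pos by (intro mult_mono) auto
    moreover have "(- 1 / 3) * s4 \<le> (1 - h) * s4"
      using h2 pos by (intro mult_right_mono) auto
    moreover have "(2 * q + 1 - p) * s2 \<le> (9 / 4 * q + 1) * s2"
      using p pos by (intro mult_right_mono) auto
    moreover have "(9 / 4 * q + 1) * s2 = 9 / 4 * (q * s2) + s2" by (simp add: algebra_simps)
    moreover have "16 * s2 \<le> q * s2" using q pos by (intro mult_right_mono) auto
    ultimately show False using 0 dbl pos by linarith
  qed
  have E0: "(q - 1) * E \<noteq> 0" unfolding EW using K0 W0 q by auto
  have "Z * ((q - 1) * E) = q * K * (Z * W)" unfolding EW by simp
  \<comment> \<open>The definition of E rewrites the coefficients, for instance q^2 G - 2 q E = 2
    q^2 K G + 4 q^2 K H for s1.\<close>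
  also have "\<dots> = - (q * (2 * E - q * G)) * s1 - (2 * q * G * K * (2 * q - p + 1)) * s2
      - (q * G * (1 - 4 * K) - 2 * E) * s4"
    unfolding ZW E by (simp add: algebra_simps)
  finally have "Z = (- (q * (2 * E - q * G)) * s1 - (2 * q * G * K * (2 * q - p + 1)) * s2
      - (q * G * (1 - 4 * K) - 2 * E) * s4) / ((q - 1) * E)"
    using E0 by (simp only: nonzero_eq_divide_eq not_False_eq_True)
  moreover have "(u * s1 - v * s2 - w * s4) / d = u / d * s1 - v / d * s2 - w / d * s4" for u v w d
    by (simp add: diff_divide_distrib)
  ultimately show ?thesis by (simp only:)
qed

theorem mainTheorem4:
  fixes m :: nat
  assumes "m \<ge> 1"
  shows "zeta (real (4*m+1)) =
    - (16 ^ m * (2 * E_coeff m - 16 ^ m * G_coeff (2*m))) / ((16 ^ m - 1) * E_coeff m)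
        * S_sum (4*m+1) 1
    - (2 * 16 ^ m * G_coeff (2*m) * K_coeff m * (2 * 16 ^ m - (-4) ^ m + 1))
        / ((16 ^ m - 1) * E_coeff m) * S_sum (4*m+1) 2
    - (16 ^ m * G_coeff (2*m) * (1 - 4 * K_coeff m) - 2 * E_coeff m)
        / ((16 ^ m - 1) * E_coeff m) * S_sum (4*m+1) 4"
proof (rule zeta_by_elimination)
  have N: "4 * m + 1 \<ge> 2" using assms by simp
  have pow: "(4::real) ^ (2 * m) = 16 ^ m" "(2::real) ^ (4 * m) = 16 ^ m" "(2::real) ^ (4 * m + 1) = 2 * 16 ^ m"
    by (simp_all add: power_mult)
  \<comment> \<open>Together with 4 <= 4^m this bounds |(-4)^m| = 4^m by 16^m / 4.\<close>
  have q: "(16::real) ^ m = 4 ^ m * 4 ^ m" by (simp flip: power_mult_distrib)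
  have "(4::real) ^ 1 \<le> 4 ^ m" using assms by (intro power_increasing) auto
  hence t: "(4::real) \<le> 4 ^ m" by simp
  show "(16::real) \<le> 16 ^ m" using power_increasing[OF assms, of "16::real"] by simp
  show "\<bar>(-4::real) ^ m\<bar> \<le> 16 ^ m / 4"
    using mult_right_mono[OF t, of "4 ^ m"] by (simp add: q power_abs)
  show "(2 * pi) ^ (4 * m + 1) > 0" by simp
  show "zeta (real (4*m+1)) > 0" by (rule zeta_pos[OF N])
  show "S_sum (4*m+1) 2 > 0" "S_sum (4*m+1) 4 > 0" by (rule S_sum_pos[OF N]; simp)+
  show "2 * S_sum (4*m+1) 2 \<le> S_sum (4*m+1) 1" using S_sum_double[OF N, of 1] by simp
  show "2 * S_sum (4*m+1) 4 \<le> S_sum (4*m+1) 2" using S_sum_double[OF N, of 2] by simp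
  show "K_coeff m = 1 / 2 * (1 - 16 ^ m) / (1 + (-4) ^ m - 2 * 16 ^ m)"
    unfolding K_coeff_def pow ..
  show "E_coeff m = 16 ^ m / 2 * G_coeff (2*m) - 2 * 16 ^ m * K_coeff m * H_coeff m
      - 16 ^ m * K_coeff m * G_coeff (2*m)"
    unfolding E_coeff_def pow ..
qed (rule zeta_S_sum_relation_1_4[OF assms] zeta_S_sum_relation_1_2_4[OF assms])+

end
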